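(* Let $d\geq 2$, let $A\subset\mathbb{R}^d$ have positive reach and let $a\in T_1^+(A)$. Then there exist a $1$-dimensional $C^{1,1}$ surface $\Gamma$ and $\delta>0$ such that $$T_1(A)\cap B(a,\delta)\subset\Gamma\cap B(a,\delta)\subset A.$$
   Context: A set $A\subset\mathbb{R}^d$ has positive reach if there is $\varepsilon>0$ such that every $x$ with $\mathrm{dist}(x,A)<\varepsilon$ has a unique nearest point in $A$. $\operatorname{Tan}(A,x)$ is the tangent cone ($u\in\operatorname{Tan}(A,x)$ iff $u=0$ or $r_i(x_i-x)\to u$ for some $x\neq x_i\in A$, $x_i\to x$, $r_i>0$). $T_1(A)$ is the set of $x\in A$ with $\dim\operatorname{span}\operatorname{Tan}(A,x)=1$, and $T_1^+(A)$ is the set of $x\in T_1(A)$ for which $\operatorname{Tan}(A,x)=\operatorname{span}\operatorname{Tan}(A,x)$ (i.e. the tangent cone is a full line). A $1$-dimensional $C^{1,1}$ surface is a set $\{w+\varphi(w):w\in W\}$ with $W$ a one-dimensional linear subspace and $\varphi:W\to W^\perp$ differentiable with Lipschitz derivative. *)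

theory Defs
  imports "HOL-Analysis.Analysis"
begin

definition nearest_point :: "'a::metric_space set \<Rightarrow> 'a \<Rightarrow> 'a \<Rightarrow> bool" where
  "nearest_point A x y \<longleftrightarrow> y \<in> A \<and> (\<forall>z\<in>A. dist x y \<le> dist x z)"

definition positive_reach :: "'a::metric_space set \<Rightarrow> bool" where
  "positive_reach A \<longleftrightarrow> (\<exists>\<epsilon>>0. \<forall>x. infdist x A < \<epsilon> \<longrightarrow> (\<exists>!y. nearest_point A x y))"

definition Tan :: "'a::real_normed_vector set \<Rightarrow> 'a \<Rightarrow> 'a set" where
  "Tan A x = {u. u = 0 \<or> (\<exists>xs r. (\<forall>i. xs i \<in> A \<and> xs i \<noteq> x \<and> r i > 0) \<and>
      xs \<longlonglongrightarrow> x \<and> (\<lambda>i. r i *\<^sub>R (xs i - x)) \<longlonglongrightarrow> u)}"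

definition T1 :: "'a::euclidean_space set \<Rightarrow> 'a set" where
  "T1 A = {x \<in> A. dim (span (Tan A x)) = 1}"

definition T1_plus :: "'a::euclidean_space set \<Rightarrow> 'a set" where
  "T1_plus A = {x \<in> T1 A. Tan A x = span (Tan A x)}"

definition C11_surface_1 :: "'a::euclidean_space set \<Rightarrow> bool" where
  "C11_surface_1 \<Gamma> \<longleftrightarrow> (\<exists>W \<phi> \<phi>'.
      subspace W \<and> dim W = 1 \<and>
      (\<forall>w\<in>W. \<forall>v\<in>W. \<phi> w \<bullet> v = 0) \<and>
      (\<forall>w\<in>W. (\<phi> has_derivative \<phi>' w) (at w within W)) \<and>
      (\<exists>L. \<forall>w\<in>W. \<forall>v\<in>W. \<forall>h\<in>W. norm (\<phi>' w h - \<phi>' v h) \<le> L * dist w v * norm h) \<and>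
      \<Gamma> = (\<lambda>w. w + \<phi> w) ` W)"

end

theory Submission
  imports Defs
begin

text \<open>
  If \<open>p\<close> is nearest to \<open>m \<notin> A\<close>, Brouwer's theorem extends the normal segment from \<open>p\<close> through \<open>m\<close>
  up to the reach, so \<open>A\<close> avoids a fixed-size ball touching it at \<open>p\<close>; hence the midpoint of
  \<open>x, y \<in> A\<close> is within \<open>|x - y|\<^sup>2 / 4r\<close> of \<open>A\<close>. In a chain of points of \<open>A\<close> minimizing the sum of
  squared steps between fixed ends, every point is nearest in \<open>A\<close> to the midpoint of its neighbours,
  so the second differences are quadratically small. Refining the chain gives a \<open>C\<^sup>1\<^sup>,\<^sup>1\<close> curve in
  \<open>A\<close> between any two close points \<open>x, y\<close>, and its initial velocity is a tangent vector at \<open>x\<close> that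
  differs from \<open>y - x\<close> by \<open>O(|y - x|\<^sup>2)\<close>.

  Since \<open>Tan(A, a)\<close> is a full line \<open>W\<close>, such a curve joins two points of \<open>A\<close> on opposite sides of \<open>a\<close>
  and is a graph over \<open>W\<close>. By the tangent estimate, \<open>Tan(A, x)\<close> is nearly parallel to \<open>W\<close> for every
  \<open>x \<in> T\<^sub>1(A)\<close> near \<open>a\<close>, so \<open>x\<close> is the only nearby point of \<open>A\<close> in its fibre orthogonal to \<open>W\<close> and
  the curve has to pass through \<open>x\<close>.
\<close>

section \<open>Nearest points and normals\<close>

lemma nearest_point_dist_eq_infdist:
  assumes "nearest_point A x p"
  shows "dist x p = infdist x A"
proof (rule antisym)
  have "A \<noteq> {}" using assms by (auto simp: nearest_point_def)
  then show "dist x p \<le> infdist x A"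
    using assms by (auto simp: nearest_point_def infdist_def intro!: cINF_greatest)
  show "infdist x A \<le> dist x p"
    using assms by (auto simp: nearest_point_def intro: infdist_le)
qed

lemma nearest_point_iff_infdist:
  "nearest_point A x p \<longleftrightarrow> p \<in> A \<and> dist x p = infdist x A"
proof
  assume "nearest_point A x p"
  then show "p \<in> A \<and> dist x p = infdist x A"
    using nearest_point_dist_eq_infdist by (auto simp: nearest_point_def)
next
  assume "p \<in> A \<and> dist x p = infdist x A"
  then show "nearest_point A x p"
    by (auto simp: nearest_point_def infdist_le)
qed

lemma nearest_point_between:
  fixes A :: "'a::real_normed_vector set"
  assumes "nearest_point A (p + t *\<^sub>R u) p" and "0 \<le> s" "s \<le> t"
  shows "nearest_point A (p + s *\<^sub>R u) p"
  unfolding nearest_point_def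
proof (intro conjI ballI)
  show "p \<in> A" using assms by (simp add: nearest_point_def)
  fix z assume "z \<in> A"
  then have "dist (p + t *\<^sub>R u) p \<le> dist (p + t *\<^sub>R u) z"
    using assms by (simp add: nearest_point_def)
  also have "\<dots> \<le> dist (p + t *\<^sub>R u) (p + s *\<^sub>R u) + dist (p + s *\<^sub>R u) z"
    by (rule dist_triangle)
  also have "dist (p + t *\<^sub>R u) (p + s *\<^sub>R u) = (t - s) * norm u"
    using assms by (simp add: dist_norm scaleR_diff_left[symmetric])
  finally show "dist (p + s *\<^sub>R u) p \<le> dist (p + s *\<^sub>R u) z"
    using assms by (simp add: dist_norm algebra_simps)
qed

section \<open>Extension of normal segments up to the reach\<close>

definition unique_nearest_within :: "real \<Rightarrow> 'a::metric_space set \<Rightarrow> bool" where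
  "unique_nearest_within e A \<longleftrightarrow> 0 < e \<and> (\<forall>x. infdist x A < e \<longrightarrow> (\<exists>!y. nearest_point A x y))"

lemma unique_nearest_within_closed:
  assumes "unique_nearest_within e A" 
  shows "closed A"
proof (cases "A = {}")
  case False
  have "x \<in> A" if "x \<in> closure A" for x
  proof -
    have "infdist x A = 0" using that False by (simp add: in_closure_iff_infdist_zero)
    then obtain y where "nearest_point A x y"
      using assms unfolding unique_nearest_within_def by force
    then have "y \<in> A" "dist x y = 0"
      using \<open>infdist x A = 0\<close> by (auto simp: nearest_point_iff_infdist)
    then show ?thesis by simp
  qed
  then show ?thesis by (metis closure_subset closure_eq subset_antisym subsetI)
qed simp

text \<open>A closed graph with values in a compact set forces continuity. Uniqueness identifies the
  graph of \<open>f\<close> over \<open>S\<close> with the pairs in \<open>S\<close> and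
  \<open>A\<close> at which \<open>dist\<close> equals \<open>infdist\<close>, and that set is
  closed.\<close>

lemma continuous_on_nearest_point:
  fixes A :: "'a::euclidean_space set"
  assumes A: "unique_nearest_within e A"
    and S: "compact S" "\<And>y. y \<in> S \<Longrightarrow> nearest_point A y (f y) \<and> infdist y A < e"
  shows "continuous_on S f"
proof -
  have "closed A" using A by (rule unique_nearest_within_closed)
  obtain B where B: "\<And>y. y \<in> S \<Longrightarrow> norm y \<le> B"
    using compact_imp_bounded[OF S(1)] unfolding bounded_iff by auto
  have sub: "f ` S \<subseteq> cball 0 (B + e)"
  proof clarify
    fix y assume y: "y \<in> S"
    have "dist y (f y) < e"
      using S(2)[OF y] by (simp add: nearest_point_iff_infdist)
    then show "f y \<in> cball 0 (B + e)"
      using B[OF y] norm_triangle_sub[of "f y" y] by (simp add: dist_norm norm_minus_commute)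
  qed
  have eq: "(\<lambda>x. Pair x (f x)) ` S = {z. fst z \<in> S \<and> snd z \<in> A \<and> dist (fst z) (snd z) = infdist (fst z) A}"
    (is "_ = ?R")
  proof (intro set_eqI iffI)
    fix z assume "z \<in> ?R"
    then have "nearest_point A (fst z) (snd z)" "fst z \<in> S"
      by (auto simp: nearest_point_iff_infdist)
    moreover from this S(2) A have "snd z = f (fst z)"
      unfolding unique_nearest_within_def by blast
    ultimately show "z \<in> (\<lambda>x. Pair x (f x)) ` S" by (cases z) auto
  qed (use S(2) in \<open>auto simp: nearest_point_iff_infdist\<close>)
  have "closed {z. fst z \<in> S}" "closed {z. snd z \<in> A}"
    using closed_vimage_fst[of S] closed_vimage_snd[of A] compact_imp_closed[OF S(1)] \<open>closed A\<close>
    by (auto simp: vimage_def)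
  moreover have "closed {z::'a\<times>'a. dist (fst z) (snd z) = infdist (fst z) A}"
    by (intro closed_Collect_eq continuous_intros)
  ultimately have "closed ?R" by (intro closed_Collect_conj)
  then show ?thesis
    using continuous_from_closed_graph[OF compact_cball sub[THEN image_subset_iff_funcset[THEN iffD1]]] eq by simp
qed

text \<open>A fixed point \<open>y\<close> of the map below lies beyond \<open>x\<close> on the ray from its own nearest point
  through \<open>x\<close>, so \<open>x\<close> and \<open>y\<close> share their nearest point.\<close>
lemma nearest_point_extend:
  fixes A :: "'a::euclidean_space set"
  assumes A: "unique_nearest_within e A" and u: "norm u = 1"
    and p: "nearest_point A (p + s *\<^sub>R u) p"
    and \<eta>: "0 < \<eta>" "\<eta> < s" "s + \<eta> < e"
  shows "nearest_point A (p + (s + \<eta>) *\<^sub>R u) p"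
proof -
  define x where "x = p + s *\<^sub>R u"
  have s: "0 < s" using \<eta> by simp
  have dx: "infdist x A = s"
    using nearest_point_dist_eq_infdist[OF p] s u by (simp add: x_def dist_norm)
  have dy: "infdist y A < e" if "y \<in> cball x \<eta>" for y
  proof -
    have "infdist y A \<le> infdist x A + dist y x" by (rule infdist_triangle)
    also have "\<dots> \<le> s + \<eta>" using that dx by (simp add: dist_commute)
    finally show ?thesis using \<eta> by simp
  qed
  define f where "f y = (THE z. nearest_point A y z)" for y
  have f: "nearest_point A y (f y)" if "y \<in> cball x \<eta>" for y
  proof -
    have "\<exists>!z. nearest_point A y z"
      using A dy[OF that] unfolding unique_nearest_within_def by simp
    then show ?thesis unfolding f_def by (rule theI')
  qed
  have cont: "continuous_on (cball x \<eta>) f"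
    using A dy f by (intro continuous_on_nearest_point) auto
  have ne: "norm (x - f y) > 0" if "y \<in> cball x \<eta>" for y
  proof -
    have "f y \<in> A" using f[OF that] by (simp add: nearest_point_def)
    then show ?thesis using infdist_le[of "f y" A x] dx s by (auto simp: dist_norm)
  qed
  \<comment> \<open>\<open>g\<close> moves from \<open>x\<close> a distance \<eta> straight away
    from the nearest point of \<open>y\<close>. The direction is defined because \<open>x\<close>
    has distance \<open>s > 0\<close> from \<open>A\<close>.\<close>
  define g where "g y = x + \<eta> *\<^sub>R ((x - f y) /\<^sub>R norm (x - f y))" for y
  have "continuous_on (cball x \<eta>) g"
    unfolding g_def using ne by (intro continuous_intros cont) auto
  moreover have "g \<in> cball x \<eta> \<rightarrow> cball x \<eta>"
    using ne \<eta> by (auto simp: g_def dist_norm)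
  ultimately obtain y where y: "y \<in> cball x \<eta>" "g y = y"
    using brouwer_ball[OF \<eta>(1)] by metis
  define P where "P = f y"
  define k where "k = norm (x - P)"
  define v where "v = (x - P) /\<^sub>R k"
  have k: "k > 0" using ne[OF y(1)] by (simp add: k_def P_def)
  have P: "nearest_point A y P" using f[OF y(1)] by (simp add: P_def)
  have x': "x = P + k *\<^sub>R v" using k by (simp add: v_def)
  have "y = x + \<eta> *\<^sub>R v"
    using y(2) unfolding g_def v_def P_def k_def by (rule sym)
  then have y': "y = P + (k + \<eta>) *\<^sub>R v"
    by (simp add: x' scaleR_add_left add.assoc)
  have "nearest_point A x P"
    using nearest_point_between[of A P "k + \<eta>" v k] P k \<eta> unfolding x' y' by simp
  moreover have "nearest_point A x p" using p by (simp add: x_def)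
  moreover have "infdist x A < e" using dx \<eta> by simp
  ultimately have "P = p"
    using A unfolding unique_nearest_within_def by blast
  then have "k = s" using s u by (simp add: k_def x_def)
  then have "v = u" using s \<open>P = p\<close> by (simp add: v_def x_def)
  then show ?thesis using P \<open>P = p\<close> \<open>k = s\<close> y' by simp
qed

text \<open>A continuation argument: the parameters in \<open>{0..r}\<close> at which
  \<open>p\<close> is still nearest form a compact set, and its maximum could be increased by
  \<open>nearest_point_extend\<close> if it were below \<open>r\<close>.\<close>

lemma unique_nearest_within_ray:
  fixes A :: "'a::euclidean_space set"
  assumes A: "unique_nearest_within e A" and u: "norm u = 1"
    and p: "nearest_point A (p + s *\<^sub>R u) p" and s: "0 < s" and r: "0 \<le> r" "r < e"
  shows "nearest_point A (p + r *\<^sub>R u) p"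
proof (cases "r \<le> s")
  case True
  then show ?thesis using nearest_point_between[OF p] r by simp
next
  case False
  define T where "T = {t. dist (p + t *\<^sub>R u) p = infdist (p + t *\<^sub>R u) A} \<inter> {0..r}"
  have pA: "p \<in> A" using p by (simp add: nearest_point_def)
  have "closed {t. dist (p + t *\<^sub>R u) p = infdist (p + t *\<^sub>R u) A}"
    by (intro closed_Collect_eq continuous_intros)
  then have "compact T" unfolding T_def by (rule closed_Int_compact) simp
  moreover have sT: "s \<in> T"
    using nearest_point_dist_eq_infdist[OF p] s False by (simp add: T_def)
  ultimately obtain t where t: "t \<in> T" "\<And>t'. t' \<in> T \<Longrightarrow> t' \<le> t"
    using compact_attains_sup[of T] by auto
  have "t \<ge> s" using t sT by auto
  have tp: "nearest_point A (p + t *\<^sub>R u) p" using t pA by (simp add: nearest_point_iff_infdist T_def)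
  have "t \<ge> r"
  proof (rule ccontr)
    assume "\<not> t \<ge> r"
    \<comment> \<open>\<open>t / 2\<close> keeps \<eta> below \<open>t\<close>, as the extension
      lemma demands, and \<open>r - t\<close> keeps the new parameter within
      \<open>r < e\<close>.\<close>
    define \<eta> where "\<eta> = min (t / 2) (r - t)"
    have \<eta>: "0 < \<eta>" "\<eta> < t" "t + \<eta> \<le> r" "t + \<eta> < e"
      using \<open>\<not> t \<ge> r\<close> \<open>t \<ge> s\<close> s r by (auto simp: \<eta>_def min_def)
    have "nearest_point A (p + (t + \<eta>) *\<^sub>R u) p"
      using nearest_point_extend[OF A u tp] \<eta> by simp
    then have "t + \<eta> \<in> T" using nearest_point_dist_eq_infdist \<eta> by (auto simp: T_def)
    then show False using t(2) \<eta> by force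
  qed
  then show ?thesis using nearest_point_between[OF tp] r by simp
qed

text \<open>The geometric form of reach at least \<open>r\<close>: an open ball of radius \<open>r\<close> touching \<open>A\<close> at \<open>p\<close>,
  with centre in the direction of a point projecting to \<open>p\<close>, misses \<open>A\<close>.\<close>
definition reach_at_least :: "real \<Rightarrow> 'a::real_inner set \<Rightarrow> bool" where
  "reach_at_least r A \<longleftrightarrow> 0 < r \<and> closed A \<and>
     (\<forall>m p b. nearest_point A m p \<longrightarrow> b \<in> A \<longrightarrow>
        2 * r * ((m - p) \<bullet> (b - p)) \<le> norm (m - p) * (norm (b - p))\<^sup>2)"

text \<open>Extend the normal to length \<open>r\<close>. The distance from the centre
  \<open>p + r *\<^sub>R u\<close> to \<open>b\<close> is then at least \<open>r\<close>; squaring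
  this and multiplying by \<open>norm (m - p)\<close> gives the inequality.\<close>

lemma positive_reach_imp_reach_at_least:
  fixes A :: "'a::euclidean_space set"
  assumes "positive_reach A"
  obtains r where "reach_at_least r A"
proof -
  obtain e where A: "unique_nearest_within e A"
    using assms unfolding positive_reach_def unique_nearest_within_def by blast
  then have e: "e > 0" by (simp add: unique_nearest_within_def)
  \<comment> \<open>The ray lemma reaches only lengths strictly below \<open>e\<close>; half of it
    is a convenient choice.\<close>
  define r where "r = e / 2"
  have r: "0 < r" "r < e" using e by (auto simp: r_def)
  have "2 * r * ((m - p) \<bullet> (b - p)) \<le> norm (m - p) * (norm (b - p))\<^sup>2"
    if m: "nearest_point A m p" and b: "b \<in> A" for m p b
  proof (cases "m = p")
    case False
    define s where "s = norm (m - p)"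
    define u where "u = (m - p) /\<^sub>R s"
    have s: "s > 0" using False by (simp add: s_def)
    have u: "norm u = 1" using s by (simp add: u_def s_def)
    have mp: "m - p = s *\<^sub>R u" using s by (simp add: u_def)
    then have "m = p + s *\<^sub>R u" by (simp add: algebra_simps)
    then have "nearest_point A (p + r *\<^sub>R u) p"
      using unique_nearest_within_ray[OF A u _ s] m r by simp
    then have "dist (p + r *\<^sub>R u) p \<le> dist (p + r *\<^sub>R u) b"
      using b by (simp add: nearest_point_def)
    then have "r \<le> norm ((b - p) - r *\<^sub>R u)"
      using r u by (simp add: dist_norm norm_minus_commute algebra_simps)
    then have "r\<^sup>2 \<le> (norm ((b - p) - r *\<^sub>R u))\<^sup>2" using r by (intro power_mono) auto
    also have "\<dots> = (norm (b - p))\<^sup>2 - 2 * r * (u \<bullet> (b - p)) + r\<^sup>2 * (u \<bullet> u)"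
      unfolding power2_norm_eq_inner
      by (simp add: inner_diff_left inner_diff_right inner_commute power2_eq_square algebra_simps)
    also have "u \<bullet> u = 1" using u by (simp add: dot_square_norm)
    finally have "2 * r * (u \<bullet> (b - p)) \<le> (norm (b - p))\<^sup>2" by simp
    then have "s * (2 * r * (u \<bullet> (b - p))) \<le> s * (norm (b - p))\<^sup>2"
      using s by (intro mult_left_mono) auto
    moreover have "(m - p) \<bullet> (b - p) = s * (u \<bullet> (b - p))" by (simp add: mp)
    ultimately show ?thesis unfolding s_def[symmetric] by (simp add: mult_ac)
  qed simp
  then have "reach_at_least r A"
    using r unique_nearest_within_closed[OF A] by (simp add: reach_at_least_def)
  then show thesis by (rule that)
qed

text \<open>Adding the reach inequalities for \<open>b = x\<close> and \<open>b = y\<close> cancels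
  the terms linear in the half chord \<open>h\<close>. What remains is quadratic in the distance
  \<open>s\<close> from midpoint to \<open>A\<close>, and \<open>s \<le> r\<close> absorbs its
  square.\<close>

lemma reach_at_least_midpoint:
  fixes A :: "'a::real_inner set"
  assumes A: "reach_at_least r A" and xy: "x \<in> A" "y \<in> A"
    and p: "nearest_point A (midpoint x y) p" and small: "dist x y \<le> 2 * r"
  shows "dist (midpoint x y) p \<le> (dist x y)\<^sup>2 / (4 * r)"
proof -
  define m where "m = midpoint x y"
  define h where "h = (1/2) *\<^sub>R (y - x)"
  define s where "s = norm (m - p)"
  have r: "r > 0" using A by (simp add: reach_at_least_def)
  have X: "x - p = (m - p) - h" and Y: "y - p = (m - p) + h"
    by (simp_all add: m_def h_def midpoint_def algebra_simps scaleR_half_double[symmetric] flip: scaleR_add_left)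
  have h: "4 * (h \<bullet> h) = (dist x y)\<^sup>2"
    by (simp add: h_def dist_norm norm_minus_commute dot_square_norm power_divide)
  define z where "z = m - p"
  have s2: "z \<bullet> z = s\<^sup>2" by (simp add: s_def z_def dot_square_norm)
  have "2 * r * ((m - p) \<bullet> (x - p)) \<le> s * (norm (x - p))\<^sup>2"
       "2 * r * ((m - p) \<bullet> (y - p)) \<le> s * (norm (y - p))\<^sup>2"
    using A p xy by (auto simp: reach_at_least_def s_def m_def)
  then have "2 * r * ((m - p) \<bullet> (x - p)) + 2 * r * ((m - p) \<bullet> (y - p))
      \<le> s * (norm (x - p))\<^sup>2 + s * (norm (y - p))\<^sup>2" by linarith
  then have "4 * r * s\<^sup>2 \<le> s * (2 * s\<^sup>2 + 2 * (h \<bullet> h))"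
    unfolding X Y power2_norm_eq_inner z_def[symmetric]
    by (simp add: inner_diff_left inner_diff_right inner_add_left inner_add_right s2 inner_commute[of h z] algebra_simps)
  then have "s * (4 * r * s) \<le> s * (2 * s\<^sup>2 + 2 * (h \<bullet> h))"
    by (simp add: power2_eq_square algebra_simps)
  then have *: "s = 0 \<or> 4 * r * s \<le> 2 * s\<^sup>2 + 2 * (h \<bullet> h)"
    by (auto simp: s_def mult_le_cancel_left)
  have "dist m p \<le> dist m x" using p xy by (simp add: nearest_point_def m_def)
  also have "dist m x \<le> r" using small by (simp add: m_def dist_midpoint)
  finally have "s \<le> r" by (simp add: s_def dist_norm)
  then have "s * s \<le> r * s" by (intro mult_right_mono) (auto simp: s_def)
  then have "s = 0 \<or> 4 * r * s \<le> (dist x y)\<^sup>2"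
    using * h by (auto simp: power2_eq_square)
  then show ?thesis
    using r by (auto simp: m_def[symmetric] dist_norm s_def[symmetric] field_simps)
qed

section \<open>Energy-minimizing chains\<close>

lemma nearest_point_exists:
  fixes A :: "'a::heine_borel set"
  assumes "closed A" "A \<noteq> {}"
  obtains p where "nearest_point A x p"
  using distance_attains_inf[OF assms, of x] unfolding nearest_point_def by metis

text \<open>Each refinement inserts a point of \<open>A\<close> nearest to the midpoint of every
  step. The steps halve up to a quadratic error, and these errors sum geometrically. The chain
  serves as a competitor that bounds the minimal energy.\<close>

lemma dyadic_chain:
  fixes A :: "'a::euclidean_space set"
  assumes A: "reach_at_least r A" and pq: "p \<in> A" "q \<in> A" and small: "dist p q \<le> r / 4"
  obtains c where "c 0 = p" "c (2 ^ n) = q" "\<And>i. c i \<in> A"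
    "\<And>i. i < 2 ^ n \<Longrightarrow> dist (c i) (c (Suc i)) \<le> 2 * dist p q / 2 ^ n"
proof -
  define D where "D = dist p q"
  have r: "r > 0" and cl: "closed A" using A by (auto simp: reach_at_least_def)
  have D: "0 \<le> D" "D \<le> r / 4" using small by (auto simp: D_def)
  \<comment> \<open>\<open>b n / 2 ^ n\<close> bounds the steps after \<open>n\<close> refinements.
    The increment of \<open>b\<close> is \<open>2 ^ Suc n\<close> times the midpoint error
    \<open>D\<^sup>2 / (r * 4 ^ n)\<close>; the total increment stays below
    \<open>4 * D\<^sup>2 / r \<le> D\<close>.\<close>
  define b where "b n = D + 4 * D\<^sup>2 / r * (1 - 1 / 2 ^ n)" for n :: nat
  have b0: "0 \<le> b n" for n using D r by (simp add: b_def)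
  have b2: "b n \<le> 2 * D" for n
  proof -
    have "4 * D\<^sup>2 / r * (1 - 1 / 2 ^ n) \<le> 4 * D\<^sup>2 / r * 1"
      using r by (intro mult_left_mono) auto
    also have "\<dots> \<le> D"
      using D r mult_left_mono[of "4 * D" r D] by (simp add: power2_eq_square field_simps)
    finally show ?thesis by (simp add: b_def)
  qed
  have "\<exists>c. c 0 = p \<and> c (2 ^ n) = q \<and> (\<forall>i. c i \<in> A) \<and>
           (\<forall>i < 2 ^ n. dist (c i) (c (Suc i)) \<le> b n / 2 ^ n)" for n
  proof (induction n)
    case 0
    show ?case
      by (rule exI[of _ "\<lambda>i. if i = 0 then p else q"]) (use pq in \<open>auto simp: b_def D_def\<close>)
  next
    case (Suc n)
    then obtain c where c: "c 0 = p" "c (2 ^ n) = q" "\<And>i. c i \<in> A"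
      "\<And>i. i < 2 ^ n \<Longrightarrow> dist (c i) (c (Suc i)) \<le> b n / 2 ^ n" by blast
    define B where "B = b n / 2 ^ n"
    have "B \<le> b n / 1" unfolding B_def using b0 by (intro divide_left_mono) auto
    then have B: "0 \<le> B" "B \<le> 2 * r" using b0[of n] b2[of n] D r by (auto simp: B_def)
    have "\<exists>m. nearest_point A (midpoint (c j) (c (Suc j))) m" for j
      using nearest_point_exists[OF cl] pq by blast
    then obtain m where m: "\<And>j. nearest_point A (midpoint (c j) (c (Suc j))) (m j)" by metis
    define c' where "c' i = (if even i then c (i div 2) else m (i div 2))" for i
    have bound: "B / 2 + B\<^sup>2 / (4 * r) \<le> b (Suc n) / 2 ^ Suc n"
    proof -
      have "(b n)\<^sup>2 \<le> (2 * D)\<^sup>2" using b0 b2 by (intro power_mono) auto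
      then have "(b n)\<^sup>2 / (4 * r * (2 ^ n)\<^sup>2) \<le> (2 * D)\<^sup>2 / (4 * r * (2 ^ n)\<^sup>2)"
        using r by (intro divide_right_mono) auto
      then have "B\<^sup>2 / (4 * r) \<le> D\<^sup>2 / (r * (2 ^ n)\<^sup>2)"
        by (simp add: B_def power_divide mult.commute power_mult_distrib)
      moreover have "b (Suc n) / 2 ^ Suc n = B / 2 + D\<^sup>2 / (r * (2 ^ n)\<^sup>2)"
        using r by (simp add: b_def B_def field_simps power2_eq_square)
      ultimately show ?thesis by simp
    qed
    have half: "dist (c j) (m j) \<le> B / 2 + B\<^sup>2 / (4 * r) \<and> dist (m j) (c (Suc j)) \<le> B / 2 + B\<^sup>2 / (4 * r)"
      if j: "j < 2 ^ n" for j
    proof -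
      let ?m = "midpoint (c j) (c (Suc j))"
      have d: "dist (c j) (c (Suc j)) \<le> B" using c(4)[OF j] by (simp add: B_def)
      have "dist ?m (m j) \<le> (dist (c j) (c (Suc j)))\<^sup>2 / (4 * r)"
        using d B by (intro reach_at_least_midpoint[OF A c(3) c(3) m]) auto
      also have "\<dots> \<le> B\<^sup>2 / (4 * r)" using d r by (intro divide_right_mono power_mono) auto
      finally have 1: "dist ?m (m j) \<le> B\<^sup>2 / (4 * r)" .
      have 2: "dist (c j) ?m \<le> B / 2" "dist (c (Suc j)) ?m \<le> B / 2"
        using d by (auto simp: dist_midpoint)
      show ?thesis
        using 1 2 dist_triangle[of "c j" "m j" ?m] dist_triangle[of "m j" "c (Suc j)" ?m]
        by (auto simp: dist_commute)
    qed
    have "dist (c' i) (c' (Suc i)) \<le> b (Suc n) / 2 ^ Suc n" if i: "i < 2 ^ Suc n" for i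
    proof -
      have "i div 2 < 2 ^ n" using i by auto
      from half[OF this] bound show ?thesis
        by (cases "even i") (auto simp: c'_def intro: order_trans)
    qed
    moreover have "c' i \<in> A" for i
      using c(3) m by (auto simp: c'_def nearest_point_def)
    ultimately show ?case
      using c(1,2) by (intro exI[of _ c']) (auto simp: c'_def)
  qed
  then obtain c where c: "c 0 = p" "c (2 ^ n) = q" "\<And>i. c i \<in> A"
      "\<And>i. i < 2 ^ n \<Longrightarrow> dist (c i) (c (Suc i)) \<le> b n / 2 ^ n" by blast
  show thesis
  proof (rule that[OF c(1,2,3)])
    fix i :: nat assume "i < 2 ^ n"
    from c(4)[OF this] show "dist (c i) (c (Suc i)) \<le> 2 * dist p q / 2 ^ n"
      using divide_right_mono[OF b2[of n], of "2 ^ n"] by (simp add: D_def)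
  qed
qed

section \<open>Existence and local structure of energy minimizers\<close>

definition chains :: "'a set \<Rightarrow> nat \<Rightarrow> 'a \<Rightarrow> 'a \<Rightarrow> (nat \<Rightarrow> 'a) set" where
  "chains A N p q = {x. x 0 = p \<and> x N = q \<and> (\<forall>i. x i \<in> A)}"

text \<open>Only the entries up to \<open>N\<close> count. Chains are nevertheless infinite
  sequences, so that they live in a product space where Tychonoff's theorem gives
  compactness.\<close>

definition chain_energy :: "nat \<Rightarrow> (nat \<Rightarrow> 'a::metric_space) \<Rightarrow> real" where
  "chain_energy N x = (\<Sum>i<N. (dist (x i) (x (Suc i)))\<^sup>2)"

lemma chain_energy_step_le:
  assumes "i < N"
  shows "(dist (x i) (x (Suc i)))\<^sup>2 \<le> chain_energy N x"
  unfolding chain_energy_def using assms by (intro member_le_sum) auto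

lemma chain_energy_cong:
  assumes "\<And>i. i \<le> N \<Longrightarrow> x i = y i"
  shows "chain_energy N x = chain_energy N y"
  unfolding chain_energy_def by (intro sum.cong) (auto simp: assms)

text \<open>Tychonoff's theorem on a function type. It is applied to chains here and to functions of
  a real parameter when limits are taken.\<close>

lemma compact_product_UNIV:
  fixes K :: "'i \<Rightarrow> 'a::topological_space set"
  assumes "\<And>i. compact (K i)"
  shows "compact {x. \<forall>i. x i \<in> K i}"
proof -
  have "compactin (product_topology (\<lambda>i. euclidean) UNIV) (PiE UNIV K)"
    using assms by (simp add: compactin_PiE)
  then show ?thesis
    by (simp add: euclidean_product_topology PiE_UNIV_domain Pi_def)
qed

text \<open>The direct method: a chain with energy at most \<open>E\<close> has steps at most
  \<open>sqrt E\<close>, so its entries up to \<open>N\<close> stay in fixed balls around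
  \<open>p\<close>, and the continuous energy attains its minimum on the resulting compact
  product.\<close>

lemma chain_energy_minimizer:
  fixes A :: "'a::heine_borel set"
  assumes "closed A" and c: "c \<in> chains A N p q"
  obtains x where "x \<in> chains A N p q"
    "\<And>y. y \<in> chains A N p q \<Longrightarrow> chain_energy N x \<le> chain_energy N y"
proof -
  define E where "E = chain_energy N c"
  \<comment> \<open>The coordinates at the two ends and beyond \<open>N\<close> are frozen to those
    of \<open>c\<close>, which enforces the end conditions and makes the irrelevant coordinates
    compact.\<close>
  define K where "K i = (if i = 0 \<or> i \<ge> N then {c i} else A \<inter> cball p (real i * sqrt E))" for i
  define C where "C = {x. \<forall>i. x i \<in> K i}"
  have "compact (K i)" for i
    using assms by (auto simp: K_def intro: closed_Int_compact)
  then have comp: "compact C" unfolding C_def by (rule compact_product_UNIV)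
  have trunc: "(\<lambda>i. if i \<le> N then y i else c i) \<in> C"
    if y: "y \<in> chains A N p q" and e: "chain_energy N y \<le> E" for y
  proof -
    have step: "dist (y i) (y (Suc i)) \<le> sqrt E" if "i < N" for i
      using chain_energy_step_le[OF that, of y] e by (intro real_le_rsqrt) linarith
    have "i \<le> N \<Longrightarrow> dist p (y i) \<le> real i * sqrt E" for i
    proof (induction i)
      case (Suc i)
      then show ?case
        using step[of i] dist_triangle[of p "y (Suc i)" "y i"] by (simp add: algebra_simps)
    qed (use y in \<open>simp add: chains_def\<close>)
    then show ?thesis using y c by (auto simp: C_def K_def chains_def)
  qed
  have c_in: "c \<in> C"
    using trunc[of c] c by (simp add: E_def)
  have "continuous_on C (chain_energy N)"
    unfolding chain_energy_def
    by (intro continuous_intros continuous_on_subset[OF continuous_on_product_coordinates]) auto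
  then obtain x where x: "x \<in> C" "\<And>y. y \<in> C \<Longrightarrow> chain_energy N x \<le> chain_energy N y"
    using continuous_attains_inf[OF comp, of "chain_energy N"] c_in by auto
  show thesis
  proof
    have K: "x i \<in> K i" for i using x(1) by (simp add: C_def)
    have "x i \<in> A" for i
      using K[of i] c by (auto simp: K_def chains_def split: if_splits)
    then show "x \<in> chains A N p q"
      using K[of 0] K[of N] c by (simp add: K_def chains_def)
    fix y assume y: "y \<in> chains A N p q"
    show "chain_energy N x \<le> chain_energy N y"
    proof (cases "chain_energy N y \<le> E")
      case True
      have "chain_energy N x \<le> chain_energy N (\<lambda>i. if i \<le> N then y i else c i)"
        by (intro x(2) trunc y True)
      also have "\<dots> = chain_energy N y" by (rule chain_energy_cong) simp
      finally show ?thesis .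
    next
      case False
      then show ?thesis using x(2)[OF c_in] by (simp add: E_def)
    qed
  qed
qed

text \<open>The parallelogram law. With \<open>a\<close> and \<open>b\<close> fixed, minimizing the
  two squared steps through \<open>z\<close> amounts to minimizing the distance of \<open>z\<close>
  to the midpoint.\<close>

lemma sum_dist_squares_midpoint:
  fixes a b z :: "'a::real_inner"
  shows "(dist a z)\<^sup>2 + (dist z b)\<^sup>2 = 2 * (dist (midpoint a b) z)\<^sup>2 + (dist a b)\<^sup>2 / 2"
proof -
  define m where "m = midpoint a b - z"
  define h where "h = (1/2) *\<^sub>R (a - b)"
  have "a - z = m + h" "b - z = m - h" "a - b = 2 *\<^sub>R h"
    by (simp_all add: m_def h_def midpoint_def algebra_simps flip: scaleR_add_left)
  then have "dist a z = norm (m + h)" "dist z b = norm (m - h)" "dist a b = norm (2 *\<^sub>R h)"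
    "dist (midpoint a b) z = norm m"
    unfolding m_def[symmetric] by (metis dist_norm norm_minus_commute m_def)+
  then show ?thesis
    by (simp add: power2_norm_eq_inner inner_add_left inner_add_right inner_diff_left
        inner_diff_right inner_commute power_mult_distrib)
qed

text \<open>Moving a single interior point changes just two summands of the energy, and
  \<open>sum_dist_squares_midpoint\<close> compares them.\<close>

lemma chain_energy_minimizer_nearest:
  fixes A :: "'a::real_inner set"
  assumes i: "Suc i < N" and x: "x \<in> chains A N p q"
    and min: "\<And>y. y \<in> chains A N p q \<Longrightarrow> chain_energy N x \<le> chain_energy N y"
  shows "nearest_point A (midpoint (x i) (x (Suc (Suc i)))) (x (Suc i))"
  unfolding nearest_point_def
proof (intro conjI ballI)
  show "x (Suc i) \<in> A" using x by (simp add: chains_def)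
  fix z assume z: "z \<in> A"
  let ?y = "x(Suc i := z)"
  have split: "chain_energy N w = (\<Sum>k\<in>{..<N} - {i, Suc i}. (dist (w k) (w (Suc k)))\<^sup>2)
      + ((dist (w i) (w (Suc i)))\<^sup>2 + (dist (w (Suc i)) (w (Suc (Suc i))))\<^sup>2)" for w :: "nat \<Rightarrow> 'a"
    unfolding chain_energy_def using i by (subst sum.subset_diff[of "{i, Suc i}"]) auto
  have "chain_energy N x \<le> chain_energy N ?y"
    using i x z by (intro min) (auto simp: chains_def)
  moreover have "(\<Sum>k\<in>{..<N} - {i, Suc i}. (dist (?y k) (?y (Suc k)))\<^sup>2)
      = (\<Sum>k\<in>{..<N} - {i, Suc i}. (dist (x k) (x (Suc k)))\<^sup>2)"
    by (intro sum.cong) auto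
  ultimately have "(dist (x i) (x (Suc i)))\<^sup>2 + (dist (x (Suc i)) (x (Suc (Suc i))))\<^sup>2
      \<le> (dist (x i) z)\<^sup>2 + (dist z (x (Suc (Suc i))))\<^sup>2"
    unfolding split by simp
  then have "(dist (midpoint (x i) (x (Suc (Suc i)))) (x (Suc i)))\<^sup>2
      \<le> (dist (midpoint (x i) (x (Suc (Suc i)))) z)\<^sup>2"
    unfolding sum_dist_squares_midpoint by simp
  then show "dist (midpoint (x i) (x (Suc (Suc i)))) (x (Suc i))
      \<le> dist (midpoint (x i) (x (Suc (Suc i)))) z"
    by (rule power2_le_imp_le) simp
qed

text \<open>A bootstrap in two passes. The energy bound controls the sum of all second differences,
  so every step is close to the average step. This bounds each step by \<open>2 * D / N\<close>,
  which in turn bounds each single second difference by \<open>L / N\<^sup>2\<close>.\<close>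

lemma minimizing_chain:
  fixes A :: "'a::euclidean_space set"
  assumes A: "reach_at_least r A" and pq: "p \<in> A" "q \<in> A" and small: "dist p q \<le> r / 8"
    and N: "N = 2 ^ n"
  defines "L \<equiv> 8 * (dist p q)\<^sup>2 / r"
  obtains x where "x 0 = p" "x N = q" "\<And>i. x i \<in> A"
    "\<And>i. Suc i < N \<Longrightarrow> norm ((x (Suc (Suc i)) - x (Suc i)) - (x (Suc i) - x i)) \<le> L / (real N)\<^sup>2"
    "\<And>i. i < N \<Longrightarrow> norm (real N *\<^sub>R (x (Suc i) - x i) - (q - p)) \<le> L"
proof -
  define D where "D = dist p q"
  have r: "r > 0" and cl: "closed A" using A by (auto simp: reach_at_least_def)
  have D: "0 \<le> D" "D \<le> r / 8" using small by (auto simp: D_def)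
  have N1: "real N \<ge> 1" using N by simp
  obtain c where c: "c 0 = p" "c N = q" "\<And>i. c i \<in> A"
    "\<And>i. i < N \<Longrightarrow> dist (c i) (c (Suc i)) \<le> 2 * D / real N"
    using dyadic_chain[OF A pq, of n] small r unfolding N D_def by (auto 4 4)
  have cc: "c \<in> chains A N p q" using c by (simp add: chains_def)
  obtain x where xc: "x \<in> chains A N p q" and
    min: "\<And>y. y \<in> chains A N p q \<Longrightarrow> chain_energy N x \<le> chain_energy N y"
    using chain_energy_minimizer[OF cl cc] by auto
  have x: "x 0 = p" "x N = q" "\<And>i. x i \<in> A" using xc by (auto simp: chains_def)
  define E where "E = chain_energy N x"
  have "E \<le> chain_energy N c" unfolding E_def by (rule min[OF cc])
  also have "\<dots> \<le> (\<Sum>i<N. (2 * D / real N)\<^sup>2)"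
    unfolding chain_energy_def using c(4) by (intro sum_mono power_mono) auto
  also have "\<dots> = 4 * D\<^sup>2 / real N" using N1 by (simp add: power2_eq_square)
  finally have E: "E \<le> 4 * D\<^sup>2 / real N" .
  also have "\<dots> \<le> 4 * D\<^sup>2 / 1" using N1 by (intro divide_left_mono) auto
  finally have E': "E \<le> (2 * D)\<^sup>2" by (simp add: power_mult_distrib)
  define v where "v i = x (Suc i) - x i" for i
  define s where "s i = norm (v i)" for i
  have sd: "dist (x i) (x (Suc i)) = s i" for i by (simp add: s_def v_def dist_norm norm_minus_commute)
  have s0: "0 \<le> s i" for i by (simp add: s_def)
  have Es: "E = (\<Sum>i<N. (s i)\<^sup>2)" by (simp add: E_def chain_energy_def sd)
  \<comment> \<open>A crude bound without the factor \<open>1 / N\<close>; it is only there to make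
    the midpoint estimate applicable.\<close>
  have sD: "s i \<le> 2 * D" if "i < N" for i
  proof (rule power2_le_imp_le)
    show "(s i)\<^sup>2 \<le> (2 * D)\<^sup>2" using chain_energy_step_le[OF that, of x] E' by (simp add: sd E_def)
  qed (use D in simp)
  \<comment> \<open>The second difference is twice the vector from \<open>x (Suc i)\<close> to the
    midpoint of its neighbours, to which it is nearest in \<open>A\<close>.\<close>
  have dv: "norm (v (Suc i) - v i) \<le> ((s i)\<^sup>2 + (s (Suc i))\<^sup>2) / r" if i: "Suc i < N" for i
  proof -
    let ?m = "midpoint (x i) (x (Suc (Suc i)))"
    have "nearest_point A ?m (x (Suc i))"
      by (rule chain_energy_minimizer_nearest[OF i xc min])
    moreover have d: "dist (x i) (x (Suc (Suc i))) \<le> s i + s (Suc i)"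
      using dist_triangle[of "x i" "x (Suc (Suc i))" "x (Suc i)"] by (simp add: sd)
    moreover have "s i + s (Suc i) \<le> 2 * r" using sD[of i] sD[of "Suc i"] i D r by auto
    ultimately have "dist ?m (x (Suc i)) \<le> (dist (x i) (x (Suc (Suc i))))\<^sup>2 / (4 * r)"
      by (intro reach_at_least_midpoint[OF A x(3) x(3)]) auto
    also have "\<dots> \<le> (s i + s (Suc i))\<^sup>2 / (4 * r)"
      using d r by (intro divide_right_mono power_mono) auto
    also have "\<dots> \<le> (2 * ((s i)\<^sup>2 + (s (Suc i))\<^sup>2)) / (4 * r)"
      using r sum_squares_bound[of "s i" "s (Suc i)"]
      by (intro divide_right_mono) (auto simp: power2_sum)
    finally have "2 * dist ?m (x (Suc i)) \<le> ((s i)\<^sup>2 + (s (Suc i))\<^sup>2) / r" using r by (simp add: field_simps)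
    moreover have "v (Suc i) - v i = 2 *\<^sub>R (?m - x (Suc i))"
      by (simp add: v_def midpoint_def algebra_simps scaleR_2)
    ultimately show ?thesis by (simp add: dist_norm)
  qed
  have tv: "norm (v j - v i) \<le> 2 * E / r" if "i \<le> j" "j < N" for i j
  proof -
    have "norm (v j - v i) \<le> (\<Sum>k\<in>{i..<j}. ((s k)\<^sup>2 + (s (Suc k))\<^sup>2) / r)"
      using that
    proof (induction rule: dec_induct)
      case (step k)
      have "norm (v (Suc k) - v i) \<le> norm (v (Suc k) - v k) + norm (v k - v i)"
        using norm_triangle_ineq[of "v (Suc k) - v k" "v k - v i"] by simp
      then show ?case using step dv[of k] by simp
    qed simp
    also have "\<dots> = ((\<Sum>k\<in>{i..<j}. (s k)\<^sup>2) + (\<Sum>k\<in>{Suc i..<Suc j}. (s k)\<^sup>2)) / r"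
      by (simp add: sum_divide_distrib[symmetric] sum.distrib sum.shift_bounds_Suc_ivl del: sum.op_ivl_Suc)
    also have "\<dots> \<le> (E + E) / r"
      unfolding Es using that r by (intro divide_right_mono add_mono sum_mono2) auto
    finally show ?thesis by simp
  qed
  have "2 * E / r \<le> 2 * (4 * D\<^sup>2 / real N) / r" using E r by (intro divide_right_mono) auto
  then have ELN: "2 * E / r \<le> L / real N" by (simp add: L_def D_def algebra_simps)
  have tv': "norm (v j - v i) \<le> L / real N" if "i < N" "j < N" for i j
    using tv[of i j] tv[of j i] that ELN
    by (cases "i \<le> j") (auto simp: norm_minus_commute)
  have avg: "norm (real N *\<^sub>R v j - (q - p)) \<le> L" if "j < N" for j
  proof -
    have "q - p = (\<Sum>i<N. v i)" using x(1,2) by (simp add: v_def sum_lessThan_telescope)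
    then have "real N *\<^sub>R v j - (q - p) = (\<Sum>i<N. v j - v i)"
      by (simp add: sum_subtractf scaleR_conv_of_real sum_constant_scaleR)
    then have "norm (real N *\<^sub>R v j - (q - p)) \<le> (\<Sum>i<N. L / real N)"
      using tv' that by (simp only:) (intro sum_norm_le, auto)
    then show ?thesis using N1 by simp
  qed
  \<comment> \<open>Here \<open>D \<le> r / 8\<close> is exactly what is needed.\<close>
  have LD: "L \<le> D"
    using D r mult_left_mono[of "8 * D" r D] by (simp add: L_def D_def[symmetric] power2_eq_square field_simps)
  have sN: "s j \<le> 2 * D / real N" if "j < N" for j
  proof -
    have "norm (real N *\<^sub>R v j) \<le> norm (real N *\<^sub>R v j - (q - p)) + norm (q - p)"
      using norm_triangle_ineq[of "real N *\<^sub>R v j - (q - p)" "q - p"] by simp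
    also have "\<dots> \<le> 2 * D" using avg[OF that] LD by (simp add: D_def dist_norm norm_minus_commute)
    finally show ?thesis using N1 by (simp add: s_def field_simps)
  qed
  have sec: "norm (v (Suc i) - v i) \<le> L / (real N)\<^sup>2" if i: "Suc i < N" for i
  proof -
    have "(s i)\<^sup>2 \<le> (2 * D / real N)\<^sup>2" "(s (Suc i))\<^sup>2 \<le> (2 * D / real N)\<^sup>2"
      using sN i s0 by (auto intro!: power_mono)
    then have "((s i)\<^sup>2 + (s (Suc i))\<^sup>2) / r \<le> (2 * (2 * D / real N)\<^sup>2) / r"
      using r by (intro divide_right_mono) auto
    also have "\<dots> = L / (real N)\<^sup>2" by (simp add: L_def D_def power_divide power_mult_distrib)
    finally show ?thesis using dv[OF i] by linarith
  qed
  show thesis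
    by (rule that[OF x]) (use sec avg in \<open>auto simp: v_def\<close>)
qed

section \<open>Curves as limits of chains\<close>

text \<open>A discrete Taylor formula: summing the second differences once bounds the drift of the
  velocity, summing again bounds the remainder. Integer indices cover both directions.\<close>

lemma second_difference_bound:
  fixes X :: "int \<Rightarrow> 'a::real_normed_vector"
  assumes K: "\<And>i. norm ((X (i + 2) - X (i + 1)) - (X (i + 1) - X i)) \<le> K"
  shows "norm (X j - X i - of_int (j - i) *\<^sub>R (X (i + 1) - X i)) \<le> K * (of_int (j - i))\<^sup>2"
proof -
  define V where "V i = X (i + 1) - X i" for i
  have K0: "0 \<le> K" using K[of 0] norm_ge_zero order_trans by blast
  have V1: "norm (V (i + 1) - V i) \<le> K" for i using K[of i] by (simp add: V_def add.assoc)
  have V: "norm (V (i + int k) - V i) \<le> K * real k" for i k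
  proof (induction k)
    case (Suc k)
    have "V (i + int (Suc k)) - V i = (V (i + int k + 1) - V (i + int k)) + (V (i + int k) - V i)"
      by (simp add: algebra_simps)
    then have "norm (V (i + int (Suc k)) - V i) \<le> K + K * real k"
      using norm_triangle_mono[OF V1 Suc] by metis
    then show ?case by (simp add: algebra_simps)
  qed simp
  have sq: "K * (real k)\<^sup>2 + K * real (Suc k) \<le> K * (real (Suc k))\<^sup>2" for k
    using K0 by (simp add: power2_eq_square algebra_simps)
  have up: "norm (X (i + int k) - X i - real k *\<^sub>R V i) \<le> K * (real k)\<^sup>2" for k
  proof (induction k)
    case (Suc k)
    have "X (i + int (Suc k)) - X i - real (Suc k) *\<^sub>R V i
        = (X (i + int k) - X i - real k *\<^sub>R V i) + (V (i + int k) - V i)"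
      by (simp add: V_def algebra_simps)
    then have "norm (X (i + int (Suc k)) - X i - real (Suc k) *\<^sub>R V i) \<le> K * (real k)\<^sup>2 + K * real k"
      using norm_triangle_mono[OF Suc V] by metis
    also have "\<dots> \<le> K * (real k)\<^sup>2 + K * real (Suc k)" using K0 by (simp add: mult_left_mono)
    finally show ?case using sq[of k] by linarith
  qed simp
  have down: "norm (X (i - int k) - X i + real k *\<^sub>R V i) \<le> K * (real k)\<^sup>2" for k
  proof (induction k)
    case (Suc k)
    have "X (i - int (Suc k)) - X i + real (Suc k) *\<^sub>R V i
        = (X (i - int k) - X i + real k *\<^sub>R V i) + (V (i - int (Suc k) + int (Suc k)) - V (i - int (Suc k)))"
      by (simp add: V_def algebra_simps)
    then have "norm (X (i - int (Suc k)) - X i + real (Suc k) *\<^sub>R V i) \<le> K * (real k)\<^sup>2 + K * real (Suc k)"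
      using norm_triangle_mono[OF Suc V] by metis
    then show ?case using sq[of k] by linarith
  qed simp
  show ?thesis
  proof (cases "i \<le> j")
    case True
    then show ?thesis using up[of "nat (j - i)"] by (simp add: V_def)
  next
    case False
    then show ?thesis using down[of "nat (i - j)"]
      by (simp add: V_def power2_commute[of "of_int i"] scaleR_diff_left algebra_simps)
  qed
qed

text \<open>Repeating the first and the last step outside the index range creates only zero second
  differences there. The limit curve is thereby defined on the whole real line, as a graph over a
  full line requires.\<close>

lemma affine_extension_of_chain:
  fixes x :: "nat \<Rightarrow> 'a::real_normed_vector"
  assumes N: "N \<ge> 1" and K: "0 \<le> K"
    "\<And>i. Suc i < N \<Longrightarrow> norm ((x (Suc (Suc i)) - x (Suc i)) - (x (Suc i) - x i)) \<le> K"
  obtains X :: "int \<Rightarrow> 'a" where "\<And>i. i \<le> N \<Longrightarrow> X (int i) = x i"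
    "\<And>i. norm ((X (i + 2) - X (i + 1)) - (X (i + 1) - X i)) \<le> K"
    "\<And>i. \<exists>j<N. X (i + 1) - X i = x (Suc j) - x j"
proof -
  \<comment> \<open>Clamps \<open>i\<close> to the step indices from \<open>0\<close> to
    \<open>N - 1\<close>.\<close>
  define c where "c i = nat (min (max i 0) (int N - 1))" for i
  define w where "w i = x (Suc (c i)) - x (c i)" for i
  define X where "X i = (if i < 0 then x 0 + of_int i *\<^sub>R w 0 else if i \<le> int N then x (nat i)
      else x N + of_int (i - int N) *\<^sub>R w (int N))" for i
  have cN: "c i < N" for i using N by (auto simp: c_def)
  have w0: "w i = w 0" if "i < 0" for i using that N by (simp add: w_def c_def)
  have wN: "w i = w (int N)" if "i \<ge> int N" for i using that N by (simp add: w_def c_def)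
  have step: "X (i + 1) - X i = w i" for i
  proof -
    consider "i + 1 < 0" | "i + 1 = 0" | "0 \<le> i" "i < int N" | "i = int N" | "i > int N" by linarith
    then show ?thesis
    proof cases
      case 1
      then show ?thesis using w0[of i] by (simp add: X_def algebra_simps)
    next
      case 2
      then have "i = -1" by simp
      then show ?thesis using w0[of i] by (simp add: X_def)
    next
      case 3
      then have "c i = nat i" "nat (i + 1) = Suc (nat i)" by (auto simp: c_def)
      then show ?thesis using 3 by (simp add: X_def w_def)
    next
      case 4
      then show ?thesis by (simp add: X_def)
    next
      case 5
      then show ?thesis using wN[of i] by (simp add: X_def algebra_simps)
    qed
  qed
  show thesis
  proof
    show "X (int i) = x i" if "i \<le> N" for i using that by (simp add: X_def)
    show "\<exists>j<N. X (i + 1) - X i = x (Suc j) - x j" for i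
      using cN[of i] step[of i] by (auto simp: w_def)
    show "norm ((X (i + 2) - X (i + 1)) - (X (i + 1) - X i)) \<le> K" for i
    proof -
      have "X (i + 2) - X (i + 1) = w (i + 1)" using step[of "i + 1"] by (simp add: add.assoc)
      moreover have "c (i + 1) = c i \<or> (c (i + 1) = Suc (c i) \<and> Suc (c i) < N)"
        using N by (auto simp: c_def)
      then have "norm (w (i + 1) - w i) \<le> K"
        using K by (auto simp: w_def)
      ultimately show ?thesis by (simp add: step)
    qed
  qed
qed

text \<open>A substitute for a diagonal subsequence, the index set being possibly uncountable:
  compactness of the product gives a cluster point \<open>h\<close>, and a filter finer than
  \<open>sequentially\<close> converges to it at all \<open>t\<close> simultaneously.\<close>

lemma pointwise_cluster_filter:
  fixes H :: "nat \<Rightarrow> 'i \<Rightarrow> 'a::euclidean_space"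
  assumes "\<And>n t. norm (H n t) \<le> B t"
  obtains F h where "F \<noteq> bot" "F \<le> sequentially" "\<And>t. ((\<lambda>n. H n t) \<longlongrightarrow> h t) F"
proof -
  define C where "C = {x. \<forall>t. x t \<in> cball (0::'a) (B t)}"
  have "compact C" unfolding C_def by (intro compact_product_UNIV) simp
  moreover have "filtermap H sequentially \<noteq> bot" by (simp add: filtermap_bot_iff)
  moreover have "eventually (\<lambda>x. x \<in> C) (filtermap H sequentially)"
    using assms by (simp add: eventually_filtermap C_def)
  ultimately obtain h where h: "inf (nhds h) (filtermap H sequentially) \<noteq> bot"
    unfolding compact_filter by blast
  \<comment> \<open>Restricts to those large \<open>n\<close> for which \<open>H n\<close> is close
    to \<open>h\<close>; this is nontrivial because \<open>h\<close> is a cluster point.\<close>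
  define F where "F = inf sequentially (filtercomap H (nhds h))"
  have "F \<noteq> bot"
  proof
    assume "F = bot"
    then have "eventually (\<lambda>_. False) F" by simp
    then obtain P Q where P: "eventually P sequentially" and "eventually Q (filtercomap H (nhds h))"
      and PQ: "\<And>n. P n \<Longrightarrow> Q n \<Longrightarrow> False"
      unfolding F_def eventually_inf by auto
    then obtain R where R: "eventually R (nhds h)" "\<And>n. R (H n) \<Longrightarrow> Q n"
      unfolding eventually_filtercomap by auto
    have "eventually (\<lambda>y. \<not> R y) (filtermap H sequentially)"
      unfolding eventually_filtermap using P by eventually_elim (use PQ R in blast)
    with R(1) have "eventually (\<lambda>_. False) (inf (nhds h) (filtermap H sequentially))"
      unfolding eventually_inf by blast
    then show False using h by (simp add: trivial_limit_def)
  qed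
  moreover have "F \<le> sequentially" by (simp add: F_def)
  moreover have "((\<lambda>n. H n t) \<longlongrightarrow> h t) F" for t
  proof -
    have "(H \<longlongrightarrow> h) F"
      unfolding F_def filterlim_def
      by (rule order_trans[OF filtermap_mono[OF inf_le2]]) (rule filtermap_filtercomap)
    then have F: "eventually (\<lambda>n. H n \<in> U) F" if "open U" "h \<in> U" for U
      using that by (rule topological_tendstoD)
    show ?thesis
    proof (rule topological_tendstoI)
      fix S :: "'a set" assume S: "open S" "h t \<in> S"
      have "open ((\<lambda>x::'i \<Rightarrow> 'a. x t) -` S)"
        using S(1) by (intro open_vimage continuous_on_product_coordinates)
      from F[OF this] S(2) show "eventually (\<lambda>n. H n t \<in> S) F" by simp
    qed
  qed
  ultimately show thesis by (rule that)
qed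

lemma floor_mult_power2_div_bounds:
  fixes t :: real
  shows "t - 1 / 2 ^ n \<le> of_int \<lfloor>t * 2 ^ n\<rfloor> / 2 ^ n" "of_int \<lfloor>t * 2 ^ n\<rfloor> / 2 ^ n \<le> t"
proof -
  have "t * 2 ^ n - 1 \<le> of_int \<lfloor>t * 2 ^ n\<rfloor>" by linarith
  then have "(t * 2 ^ n - 1) / 2 ^ n \<le> of_int \<lfloor>t * 2 ^ n\<rfloor> / 2 ^ n"
    by (intro divide_right_mono) auto
  then show "t - 1 / 2 ^ n \<le> of_int \<lfloor>t * 2 ^ n\<rfloor> / 2 ^ n" by (simp add: diff_divide_distrib)
qed (simp add: field_simps)

lemma floor_mult_power2_div_tendsto: "(\<lambda>n. of_int \<lfloor>t * 2 ^ n\<rfloor> / 2 ^ n) \<longlonglongrightarrow> (t::real)"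
proof (rule real_tendsto_sandwich[where h = "\<lambda>_. t"])
  have "(\<lambda>n. t - (1 / 2) ^ n) \<longlonglongrightarrow> t - 0" by (intro tendsto_intros) auto
  then show "(\<lambda>n. t - 1 / 2 ^ n) \<longlonglongrightarrow> t" by (simp add: power_divide)
qed (simp_all add: floor_mult_power2_div_bounds)

text \<open>Limits of discrete energy minimizers. The quadratic Taylor estimate with remainder constant
  \<open>L\<close> at every pair of points encodes that \<open>g\<close> is the derivative of \<open>\<gamma>\<close> and is Lipschitz.\<close>
lemma C11_curve_in_reach:
  fixes A :: "'a::euclidean_space set"
  assumes A: "reach_at_least r A" and pq: "p \<in> A" "q \<in> A" and small: "dist p q \<le> r / 8"
  defines "L \<equiv> 8 * (dist p q)\<^sup>2 / r"
  obtains \<gamma> g :: "real \<Rightarrow> 'a" where "\<gamma> 0 = p" "\<gamma> 1 = q" "\<And>t. 0 \<le> t \<Longrightarrow> t \<le> 1 \<Longrightarrow> \<gamma> t \<in> A"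
    "\<And>s t. norm (\<gamma> t - \<gamma> s - (t - s) *\<^sub>R g s) \<le> L * (t - s)\<^sup>2"
    "\<And>t. norm (g t - (q - p)) \<le> L"
proof -
  have r: "r > 0" and cl: "closed A" using A by (auto simp: reach_at_least_def)
  have L: "0 \<le> L" using r by (simp add: L_def)
  have "\<exists>X :: int \<Rightarrow> 'a. X 0 = p \<and> X (2 ^ n) = q \<and> (\<forall>i. 0 \<le> i \<longrightarrow> i \<le> 2 ^ n \<longrightarrow> X i \<in> A) \<and>
      (\<forall>i. norm ((X (i + 2) - X (i + 1)) - (X (i + 1) - X i)) \<le> L / (2 ^ n)\<^sup>2) \<and>
      (\<forall>i. norm (2 ^ n *\<^sub>R (X (i + 1) - X i) - (q - p)) \<le> L)" for n
  proof -
    define N where "N = (2::nat) ^ n"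
    have rN: "real N = 2 ^ n" "int N = 2 ^ n" "N \<ge> 1" by (auto simp: N_def)
    obtain x where x: "x 0 = p" "x N = q" "\<And>i. x i \<in> A"
      "\<And>i. Suc i < N \<Longrightarrow> norm ((x (Suc (Suc i)) - x (Suc i)) - (x (Suc i) - x i)) \<le> L / (real N)\<^sup>2"
      "\<And>i. i < N \<Longrightarrow> norm (real N *\<^sub>R (x (Suc i) - x i) - (q - p)) \<le> L"
      using minimizing_chain[OF A pq small N_def] unfolding L_def by metis
    obtain X where X: "\<And>i. i \<le> N \<Longrightarrow> X (int i) = x i"
      "\<And>i. norm ((X (i + 2) - X (i + 1)) - (X (i + 1) - X i)) \<le> L / (real N)\<^sup>2"
      "\<And>i. \<exists>j<N. X (i + 1) - X i = x (Suc j) - x j"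
      using affine_extension_of_chain[of N "L / (real N)\<^sup>2" x] x(4) L rN(3) by auto
    have "X 0 = p" "X (2 ^ n) = q" using X(1)[of 0] X(1)[of N] x rN by auto
    moreover have "X i \<in> A" if "0 \<le> i" "i \<le> 2 ^ n" for i
      using X(1)[of "nat i"] x(3)[of "nat i"] that rN(2) by auto
    moreover have "norm (2 ^ n *\<^sub>R (X (i + 1) - X i) - (q - p)) \<le> L" for i
      using X(3)[of i] x(5) rN(1) by metis
    ultimately show ?thesis using X(2) rN(1) by (intro exI[of _ X]) auto
  qed
  then obtain X :: "nat \<Rightarrow> int \<Rightarrow> 'a" where X: "\<And>n. X n 0 = p" "\<And>n. X n (2 ^ n) = q"
    "\<And>n i. 0 \<le> i \<Longrightarrow> i \<le> 2 ^ n \<Longrightarrow> X n i \<in> A"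
    and X2: "\<And>n i. norm ((X n (i + 2) - X n (i + 1)) - (X n (i + 1) - X n i)) \<le> L / (2 ^ n)\<^sup>2"
    and X1: "\<And>n i. norm (2 ^ n *\<^sub>R (X n (i + 1) - X n i) - (q - p)) \<le> L"
    by metis
  define k where "k n t = \<lfloor>t * 2 ^ n\<rfloor>" for n and t :: real
  define \<tau> where "\<tau> n t = real_of_int (k n t) / 2 ^ n" for n t
  define f where "f n t = X n (k n t)" for n t
  define G where "G n t = 2 ^ n *\<^sub>R (X n (k n t + 1) - X n (k n t))" for n t
  have \<tau>: "(\<lambda>n. \<tau> n t) \<longlonglongrightarrow> t" for t
    unfolding \<tau>_def k_def by (rule floor_mult_power2_div_tendsto)
  have taylor: "norm (f n t - f n s - (\<tau> n t - \<tau> n s) *\<^sub>R G n s) \<le> L * (\<tau> n t - \<tau> n s)\<^sup>2" for n s t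
  proof -
    have "(\<tau> n t - \<tau> n s) *\<^sub>R G n s = of_int (k n t - k n s) *\<^sub>R (X n (k n s + 1) - X n (k n s))"
      by (simp add: \<tau>_def G_def diff_divide_distrib[symmetric])
    moreover have "L / (2 ^ n)\<^sup>2 * (of_int (k n t - k n s))\<^sup>2 = L * (\<tau> n t - \<tau> n s)\<^sup>2"
      by (simp add: \<tau>_def diff_divide_distrib[symmetric] power_divide)
    ultimately show ?thesis
      using second_difference_bound[of "X n" "L / (2 ^ n)\<^sup>2" "k n t" "k n s"] X2
      by (simp add: f_def)
  qed
  have G: "norm (G n t - (q - p)) \<le> L" for n t unfolding G_def by (rule X1)
  have f0: "f n 0 = p" "f n 1 = q" for n using X by (auto simp: f_def k_def)
  have fA: "f n t \<in> A" if "0 \<le> t" "t \<le> 1" for n t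
  proof -
    have "t * 2 ^ n \<le> 1 * 2 ^ n" using that by (intro mult_right_mono) auto
    then have "k n t \<le> \<lfloor>1 * 2 ^ n :: real\<rfloor>" unfolding k_def by (rule floor_mono)
    then have "k n t \<le> 2 ^ n" "0 \<le> k n t" using that by (auto simp: k_def)
    then show ?thesis using X(3) by (simp add: f_def)
  qed
  have Gb: "norm (G n t) \<le> L + norm (q - p)" for n t
    using G[of n t] norm_triangle_ineq[of "G n t - (q - p)" "q - p"] by simp
  \<comment> \<open>The Taylor estimate at time \<open>0\<close>, with the grid time bounded by
    \<open>\<bar>t\<bar> + 1\<close>.\<close>
  define M where "M t = norm p + L * (\<bar>t\<bar> + 1)\<^sup>2 + (\<bar>t\<bar> + 1) * (L + norm (q - p))" for t :: real
  have fb: "norm (f n t) \<le> M t" for n t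
  proof -
    have "t - 1 / 2 ^ n \<le> \<tau> n t" "\<tau> n t \<le> t"
      unfolding \<tau>_def k_def by (rule floor_mult_power2_div_bounds)+
    moreover have "1 / 2 ^ n \<le> (1::real)" by simp
    ultimately have \<tau>b: "\<bar>\<tau> n t\<bar> \<le> \<bar>t\<bar> + 1" by linarith
    have \<tau>0: "\<tau> n 0 = 0" by (simp add: \<tau>_def k_def)
    have "norm (f n t - p - \<tau> n t *\<^sub>R G n 0) \<le> L * (\<tau> n t)\<^sup>2"
      using taylor[of n t 0] by (simp add: \<tau>0 f0)
    also have "\<dots> \<le> L * (\<bar>t\<bar> + 1)\<^sup>2" using \<tau>b L by (intro mult_left_mono abs_le_square_iff[THEN iffD1]) auto
    finally have 1: "norm (f n t - p - \<tau> n t *\<^sub>R G n 0) \<le> L * (\<bar>t\<bar> + 1)\<^sup>2" .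
    have 2: "norm (\<tau> n t *\<^sub>R G n 0) \<le> (\<bar>t\<bar> + 1) * (L + norm (q - p))"
      unfolding norm_scaleR using \<tau>b Gb by (intro mult_mono) auto
    have "f n t = p + ((f n t - p - \<tau> n t *\<^sub>R G n 0) + \<tau> n t *\<^sub>R G n 0)" by simp
    then have "norm (f n t) \<le> norm p + norm ((f n t - p - \<tau> n t *\<^sub>R G n 0) + \<tau> n t *\<^sub>R G n 0)"
      using norm_triangle_ineq by metis
    also have "\<dots> \<le> norm p + (L * (\<bar>t\<bar> + 1)\<^sup>2 + (\<bar>t\<bar> + 1) * (L + norm (q - p)))"
      using norm_triangle_mono[OF 1 2] by simp
    finally show ?thesis by (simp add: M_def)
  qed
  \<comment> \<open>Positions and velocities are paired so that one filter serves both
    limits.\<close>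
  have "norm (f n t, G n t) \<le> M t + (L + norm (q - p))" for n t
    using norm_Pair_le[of "f n t" "G n t"] fb[of n t] Gb[of n t] by linarith
  then obtain F h where F: "F \<noteq> bot" "F \<le> sequentially" "\<And>t. ((\<lambda>n. (f n t, G n t)) \<longlongrightarrow> h t) F"
    using pointwise_cluster_filter[of "\<lambda>n t. (f n t, G n t)" "\<lambda>t. M t + (L + norm (q - p))"] by blast
  define \<gamma> where "\<gamma> t = fst (h t)" for t
  define g where "g t = snd (h t)" for t
  have lf: "((\<lambda>n. f n t) \<longlongrightarrow> \<gamma> t) F" and lG: "((\<lambda>n. G n t) \<longlongrightarrow> g t) F" for t
    using tendsto_fst[OF F(3)[of t]] tendsto_snd[OF F(3)[of t]] by (simp_all add: \<gamma>_def g_def)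
  have l\<tau>: "((\<lambda>n. \<tau> n t) \<longlongrightarrow> t) F" for t by (rule tendsto_mono[OF F(2) \<tau>])
  show thesis
  proof
    show "\<gamma> 0 = p" "\<gamma> 1 = q"
      using tendsto_unique[OF F(1) lf] by (auto simp: f0)
    show "\<gamma> t \<in> A" if "0 \<le> t" "t \<le> 1" for t
      using Lim_in_closed_set[OF cl _ F(1) lf[of t]] fA[OF that] by simp
    show "norm (\<gamma> t - \<gamma> s - (t - s) *\<^sub>R g s) \<le> L * (t - s)\<^sup>2" for s t
    proof (rule tendsto_le[OF F(1)])
      show "((\<lambda>n. L * (\<tau> n t - \<tau> n s)\<^sup>2) \<longlongrightarrow> L * (t - s)\<^sup>2) F"
        by (intro tendsto_intros l\<tau>)
      show "((\<lambda>n. norm (f n t - f n s - (\<tau> n t - \<tau> n s) *\<^sub>R G n s)) \<longlongrightarrow> norm (\<gamma> t - \<gamma> s - (t - s) *\<^sub>R g s)) F"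
        by (intro tendsto_intros l\<tau> lf lG)
    qed (simp add: taylor)
    show "norm (g t - (q - p)) \<le> L" for t
    proof (rule tendsto_upperbound[OF _ _ F(1)])
      show "((\<lambda>n. norm (G n t - (q - p))) \<longlongrightarrow> norm (g t - (q - p))) F"
        by (intro tendsto_intros lG)
    qed (simp add: G)
  qed
qed

section \<open>Consequences of the quadratic Taylor estimate\<close>

text \<open>In the sum of the Taylor remainders from \<open>s\<close> to \<open>t\<close> and from
  \<open>t\<close> to \<open>s\<close> the positions cancel, leaving
  \<open>(t - s) *\<^sub>R (g t - g s)\<close>.\<close>

lemma taylor_imp_lipschitz:
  fixes \<gamma> g :: "real \<Rightarrow> 'a::real_normed_vector"
  assumes taylor: "\<And>s t. norm (\<gamma> t - \<gamma> s - (t - s) *\<^sub>R g s) \<le> L * (t - s)\<^sup>2"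
  shows "norm (g t - g s) \<le> 2 * L * \<bar>t - s\<bar>"
proof (cases "t = s")
  case False
  have "(t - s) *\<^sub>R (g t - g s) = (\<gamma> t - \<gamma> s - (t - s) *\<^sub>R g s) + (\<gamma> s - \<gamma> t - (s - t) *\<^sub>R g t)"
    by (simp add: algebra_simps)
  then have "norm ((t - s) *\<^sub>R (g t - g s)) \<le> L * (t - s)\<^sup>2 + L * (s - t)\<^sup>2"
    using norm_triangle_mono[OF taylor taylor] by metis
  also have "\<dots> = 2 * L * (\<bar>t - s\<bar> * \<bar>t - s\<bar>)"
    unfolding abs_mult_self_eq power2_commute[of s t] by (simp add: power2_eq_square)
  also have "\<dots> = \<bar>t - s\<bar> * (2 * L * \<bar>t - s\<bar>)" by (simp only: mult_ac)
  finally have "\<bar>t - s\<bar> * norm (g t - g s) \<le> \<bar>t - s\<bar> * (2 * L * \<bar>t - s\<bar>)"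
    by simp
  then show ?thesis using False by (simp add: mult_le_cancel_left)
qed simp

lemma taylor_imp_has_vector_derivative:
  fixes \<gamma> g :: "real \<Rightarrow> 'a::real_normed_vector"
  assumes taylor: "\<And>s t. norm (\<gamma> t - \<gamma> s - (t - s) *\<^sub>R g s) \<le> L * (t - s)\<^sup>2"
  shows "(\<gamma> has_vector_derivative g s) (at s)"
  unfolding has_vector_derivative_def has_derivative_at
proof (intro conjI)
  show "bounded_linear (\<lambda>x. x *\<^sub>R g s)" by (rule bounded_linear_scaleR_left)
  show "(\<lambda>h. norm (\<gamma> (s + h) - \<gamma> s - h *\<^sub>R g s) / norm h) \<midarrow>0\<rightarrow> 0"
  proof (rule Lim_null_comparison)
    have "norm (\<gamma> (s + h) - \<gamma> s - h *\<^sub>R g s) / norm h \<le> L * \<bar>h\<bar>" for h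
    proof (cases "h = 0")
      case False
      have "norm (\<gamma> (s + h) - \<gamma> s - h *\<^sub>R g s) \<le> L * h\<^sup>2" using taylor[of "s + h" s] by simp
      also have "\<dots> = L * \<bar>h\<bar> * \<bar>h\<bar>" by (simp add: power2_eq_square)
      finally show ?thesis using False by (simp add: pos_divide_le_eq)
    qed simp
    then show "\<forall>\<^sub>F h in at 0. norm (norm (\<gamma> (s + h) - \<gamma> s - h *\<^sub>R g s) / norm h) \<le> L * \<bar>h\<bar>"
      by simp
    show "((\<lambda>h. L * \<bar>h\<bar>) \<longlongrightarrow> 0) (at 0)" by (rule tendsto_eq_intros | simp)+
  qed
qed

text \<open>The vector is the initial velocity of the curve in \<open>A\<close> from
  \<open>x\<close> to \<open>y\<close>.\<close>

lemma reach_tangent_estimate: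
  fixes A :: "'a::euclidean_space set"
  assumes A: "reach_at_least r A" and xy: "x \<in> A" "y \<in> A" and small: "dist x y \<le> r / 8"
  obtains u where "u \<in> Tan A x" "norm (u - (y - x)) \<le> 8 * (dist x y)\<^sup>2 / r"
proof -
  define L where "L = 8 * (dist x y)\<^sup>2 / r"
  have L: "0 \<le> L" using A by (simp add: L_def reach_at_least_def)
  obtain \<gamma> g :: "real \<Rightarrow> 'a" where \<gamma>: "\<gamma> 0 = x" "\<gamma> 1 = y" "\<And>t. 0 \<le> t \<Longrightarrow> t \<le> 1 \<Longrightarrow> \<gamma> t \<in> A"
    and taylor: "\<And>s t. norm (\<gamma> t - \<gamma> s - (t - s) *\<^sub>R g s) \<le> L * (t - s)\<^sup>2"
    and g: "\<And>t. norm (g t - (y - x)) \<le> L"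
    using C11_curve_in_reach[OF A xy small] unfolding L_def by metis
  have "g 0 \<in> Tan A x"
  proof (cases "g 0 = 0")
    case False
    \<comment> \<open>\<open>Tan\<close> asks for points other than \<open>x\<close>. At times
      \<open>1 / k\<close> with \<open>k > n\<close> the Taylor remainder is too small for the curve
      to be back at \<open>x\<close>.\<close>
    then obtain n where n: "L < real n * norm (g 0)"
      using ex_less_of_nat_mult[of "norm (g 0)" L] by auto
    define k where "k i = real (Suc (n + i))" for i
    have k: "k i \<ge> 1" for i by (simp add: k_def)
    define xs where "xs i = \<gamma> (1 / k i)" for i
    have near: "norm (k i *\<^sub>R (xs i - x) - g 0) \<le> L / k i" for i
    proof -
      have "norm (xs i - x - (1 / k i) *\<^sub>R g 0) \<le> L * (1 / k i)\<^sup>2"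
        using taylor[of "1 / k i" 0] by (simp add: xs_def \<gamma>)
      then have "k i * norm (xs i - x - (1 / k i) *\<^sub>R g 0) \<le> k i * (L * (1 / k i)\<^sup>2)"
        using k[of i] by (intro mult_left_mono) auto
      moreover have "k i *\<^sub>R (xs i - x) - g 0 = k i *\<^sub>R (xs i - x - (1 / k i) *\<^sub>R g 0)"
        using k[of i] by (simp add: scaleR_diff_right)
      ultimately show ?thesis using k[of i] by (simp add: power2_eq_square)
    qed
    have kinf: "(\<lambda>i. 1 / k i) \<longlonglongrightarrow> 0"
      unfolding k_def using LIMSEQ_ignore_initial_segment[OF lim_1_over_n, of "Suc n"]
      by (simp add: add.commute)
    have "(\<lambda>i. k i *\<^sub>R (xs i - x) - g 0) \<longlonglongrightarrow> 0"
    proof (rule Lim_null_comparison)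
      show "(\<lambda>i. L / k i) \<longlonglongrightarrow> 0" using tendsto_mult_left[OF kinf, of L] by simp
    qed (use near in simp)
    then have lim: "(\<lambda>i. k i *\<^sub>R (xs i - x)) \<longlonglongrightarrow> g 0" by (simp add: LIM_zero_iff)
    have "(\<lambda>i. (1 / k i) *\<^sub>R (k i *\<^sub>R (xs i - x))) \<longlonglongrightarrow> 0 *\<^sub>R g 0"
      by (intro tendsto_scaleR kinf lim)
    moreover have "(1 / k i) *\<^sub>R (k i *\<^sub>R (xs i - x)) = xs i - x" for i using k[of i] by simp
    ultimately have "xs \<longlonglongrightarrow> x" by (simp add: LIM_zero_iff)
    moreover have "xs i \<in> A \<and> xs i \<noteq> x \<and> k i > 0" for i
    proof (intro conjI notI)
      show "xs i \<in> A" using k[of i] by (simp add: xs_def \<gamma>(3))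
      show "k i > 0" using k[of i] by simp
      assume "xs i = x"
      then have "norm (g 0) * k i \<le> L" using near[of i] k[of i] by (simp add: field_simps)
      moreover have "real n * norm (g 0) \<le> k i * norm (g 0)"
        by (intro mult_right_mono) (auto simp: k_def)
      ultimately show False using n by (simp add: mult.commute)
    qed
    ultimately show ?thesis using lim unfolding Tan_def by blast
  qed (simp add: Tan_def)
  then show thesis using that[of "g 0"] g[of 0] unfolding L_def by blast
qed

section \<open>The curve through the points of dimension one\<close>

lemma dim_span_1_multiple:
  fixes u v :: "'a::euclidean_space"
  assumes "dim (span S) = 1" "u \<in> span S" "v \<in> span S" "u \<noteq> 0"
  obtains c where "v = c *\<^sub>R u"
proof -
  have "span {u} = span S"
    using assms by (intro subspace_dim_equal) (auto simp: span_minimal)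
  then show thesis using assms(3) that by (auto simp: span_singleton)
qed

text \<open>Some nonzero tangent vector at \<open>x\<close> is far from orthogonal to
  \<open>w\<close>, and dimension one extends this to all of them. A second point \<open>y\<close>
  in the fibre would give a tangent vector close to \<open>y - x\<close>, hence nearly orthogonal to
  \<open>w\<close>.\<close>

lemma T1_fibre_unique:
  fixes A :: "'a::euclidean_space set"
  assumes A: "reach_at_least r A" and a: "a \<in> A" "Tan A a = span {w}" and w: "norm w = 1"
    and x: "x \<in> T1 A" "dist x a \<le> r / 64" and y: "y \<in> A" "dist x y \<le> r / 64"
    and fibre: "(y - x) \<bullet> w = 0"
  shows "y = x"
proof (rule ccontr)
  assume "y \<noteq> x"
  have r: "r > 0" using A by (simp add: reach_at_least_def)
  have xA: "x \<in> A" and dim1: "dim (span (Tan A x)) = 1" using x by (auto simp: T1_def)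
  \<comment> \<open>The radius \<open>r / 64\<close> turns the quadratic error
    \<open>8 * d\<^sup>2 / r\<close> into \<open>d / 8\<close>.\<close>
  have tan: "\<exists>u\<in>Tan A z. norm (u - (z' - z)) \<le> dist z z' / 8"
    if z: "z \<in> A" "z' \<in> A" "dist z z' \<le> r / 64" for z z'
  proof -
    have "dist z z' \<le> r / 8" using z r by simp
    then obtain u where "u \<in> Tan A z" "norm (u - (z' - z)) \<le> 8 * (dist z z')\<^sup>2 / r"
      using reach_tangent_estimate[OF A z(1,2)] by blast
    moreover have "8 * (dist z z')\<^sup>2 / r \<le> dist z z' / 8"
      using mult_left_mono[OF z(3), of "dist z z'"] r by (simp add: power2_eq_square field_simps)
    ultimately show ?thesis by force
  qed
  have inner_w: "\<bar>z \<bullet> w\<bar> \<le> norm z" for z using Cauchy_Schwarz_ineq2[of z w] w by simp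
  \<comment> \<open>The tangent vectors at \<open>x\<close> towards \<open>a\<close> and at
    \<open>a\<close> towards \<open>x\<close> nearly cancel, and the latter is a multiple of
    \<open>w\<close>. With \<open>e = dist x a\<close> this gives
    \<open>\<bar>u \<bullet> w\<bar> \<ge> norm u - e / 2\<close> and
    \<open>norm u \<ge> 7 * e / 8\<close>, whence the factor one third.\<close>
  have "\<exists>u\<in>Tan A x. u \<noteq> 0 \<and> norm u / 3 \<le> \<bar>u \<bullet> w\<bar>"
  proof (cases "x = a")
    case True
    then show ?thesis using a w by (intro bexI[of _ w]) (auto simp: span_base dot_square_norm)
  next
    case False
    define e where "e = dist x a"
    have e: "e > 0" using False by (simp add: e_def)
    obtain u where u: "u \<in> Tan A x" "norm (u - (a - x)) \<le> e / 8"
      using tan[OF xA a(1)] x by (auto simp: e_def)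
    obtain v where v: "v \<in> Tan A a" "norm (v - (x - a)) \<le> e / 8"
      using tan[OF a(1) xA] x by (auto simp: e_def dist_commute)
    obtain \<alpha> where \<alpha>: "v = \<alpha> *\<^sub>R w" using v a by (auto simp: span_singleton)
    have "u + v = (u - (a - x)) + (v - (x - a))" by simp
    then have uv: "norm (u + v) \<le> e / 4" using norm_triangle_mono[OF u(2) v(2)] by simp
    have "norm (a - x) \<le> norm u + norm (u - (a - x))"
      by (metis norm_triangle_sub norm_minus_commute)
    then have un: "norm u \<ge> 7 * e / 8" using u(2) by (simp add: e_def dist_norm norm_minus_commute)
    have "norm u \<le> norm (u + v) + norm v" using norm_triangle_ineq4[of "u + v" v] by simp
    then have "\<bar>\<alpha>\<bar> \<ge> norm u - e / 4" using uv w by (simp add: \<alpha>)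
    moreover have "\<bar>u \<bullet> w + \<alpha>\<bar> \<le> e / 4"
      using inner_w[of "u + v"] uv w by (simp add: \<alpha> inner_add_left dot_square_norm)
    ultimately have "norm u - e / 2 \<le> \<bar>u \<bullet> w\<bar>" by linarith
    then have "norm u / 3 \<le> \<bar>u \<bullet> w\<bar>" using un by linarith
    moreover have "u \<noteq> 0" using un e by auto
    ultimately show ?thesis using u(1) by blast
  qed
  then obtain u where u: "u \<in> Tan A x" "u \<noteq> 0" "norm u / 3 \<le> \<bar>u \<bullet> w\<bar>" by blast
  define d where "d = dist x y"
  have d: "d > 0" using \<open>y \<noteq> x\<close> by (simp add: d_def)
  obtain v where v: "v \<in> Tan A x" "norm (v - (y - x)) \<le> d / 8"
    using tan[OF xA y(1)] y by (auto simp: d_def)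
  obtain c where c: "v = c *\<^sub>R u"
    using dim_span_1_multiple[OF dim1, of u v] u v by (auto simp: span_base)
  \<comment> \<open>The contradiction: \<open>norm v \<ge> 7 * d / 8\<close>, but
    \<open>norm v / 3 \<le> d / 8\<close>.\<close>
  have "\<bar>v \<bullet> w\<bar> = \<bar>c\<bar> * \<bar>u \<bullet> w\<bar>" by (simp add: c abs_mult)
  moreover have "\<bar>c\<bar> * (norm u / 3) \<le> \<bar>c\<bar> * \<bar>u \<bullet> w\<bar>" using u(3) by (intro mult_left_mono) auto
  ultimately have "norm v / 3 \<le> \<bar>v \<bullet> w\<bar>" by (simp add: c)
  moreover have "\<bar>v \<bullet> w\<bar> \<le> d / 8"
    using inner_w[of "v - (y - x)"] v(2) fibre by (simp add: inner_diff_left)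
  moreover have "norm (y - x) \<le> norm v + norm (v - (y - x))"
    by (metis norm_triangle_sub norm_minus_commute)
  moreover have "norm (y - x) = d" by (simp add: d_def dist_norm norm_minus_commute)
  ultimately show False using v(2) d by linarith
qed

section \<open>Curves as graphs over a line\<close>

text \<open>The height \<open>h\<close> along \<open>w\<close> has derivative at least
  \<open>c\<close>, so it is a bijection of the reals with Lipschitz inverse \<open>k\<close>.
  Reparametrizing by height turns the curve into a graph over the span of \<open>w\<close>.\<close>

lemma C11_surface_1_range:
  fixes \<gamma> g :: "real \<Rightarrow> 'a::euclidean_space"
  assumes taylor: "\<And>s t. norm (\<gamma> t - \<gamma> s - (t - s) *\<^sub>R g s) \<le> L * (t - s)\<^sup>2"
    and w: "norm w = 1" and c: "0 < c" "\<And>t. c \<le> g t \<bullet> w" and M: "\<And>t. norm (g t) \<le> M"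
  shows "C11_surface_1 (range \<gamma>)"
proof -
  have ww: "w \<bullet> w = 1" using w by (simp add: dot_square_norm)
  have inner_w: "\<bar>z \<bullet> w\<bar> \<le> norm z" for z using Cauchy_Schwarz_ineq2[of z w] w by simp
  have d\<gamma>: "(\<gamma> has_vector_derivative g s) (at s)" for s
    using taylor by (rule taylor_imp_has_vector_derivative)
  have lip: "norm (g t - g s) \<le> 2 * L * \<bar>t - s\<bar>" for s t
    using taylor by (rule taylor_imp_lipschitz)
  have L: "0 \<le> L" using order_trans[OF norm_ge_zero taylor[of 1 0]] by simp
  define h where "h t = \<gamma> t \<bullet> w" for t
  have dh: "(h has_real_derivative (g s \<bullet> w)) (at s)" for s
    using bounded_linear.has_vector_derivative[OF bounded_linear_inner_left d\<gamma>, of w s]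
    unfolding h_def has_real_derivative_iff_has_vector_derivative .
  have conth: "continuous_on S h" for S
    using dh by (intro continuous_at_imp_continuous_on) (auto intro: DERIV_isCont)
  have expand: "c * (t - s) \<le> h t - h s" if "s \<le> t" for s t
  proof (cases "s = t")
    case False
    then have "s < t" using that by simp
    then obtain z where "h t - h s = (t - s) * (g z \<bullet> w)"
      using MVT2[of s t h "\<lambda>z. g z \<bullet> w"] dh by blast
    moreover have "(t - s) * c \<le> (t - s) * (g z \<bullet> w)" using c(2) that by (intro mult_left_mono) auto
    ultimately show ?thesis by (simp add: mult.commute)
  qed simp
  have expand': "c * \<bar>t - s\<bar> \<le> \<bar>h t - h s\<bar>" for s t
    using expand[of s t] expand[of t s] by (cases "s \<le> t") auto
  have "\<exists>t. h t = u" for u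
  proof -
    \<comment> \<open>Growth at rate at least \<open>c\<close> carries \<open>h\<close> past
      \<open>u\<close> within time \<open>T\<close>.\<close>
    define T where "T = \<bar>u - h 0\<bar> / c"
    have T: "T \<ge> 0" "c * T = \<bar>u - h 0\<bar>" using c(1) by (auto simp: T_def)
    have "c * T \<le> h T - h 0" "c * T \<le> h 0 - h (- T)"
      using expand[of 0 T] expand[of "- T" 0] T(1) by simp_all
    then have "h (- T) \<le> u" "u \<le> h T" using T(2) by linarith+
    then show ?thesis using IVT'[of h "- T" u T] conth T by auto
  qed
  then obtain k where hk: "\<And>u. h (k u) = u" by metis
  have kh: "k (h t) = t" for t
    using expand'[of "k (h t)" t] c(1) by (simp add: hk mult_le_0_iff)
  have klip: "\<bar>k u - k v\<bar> \<le> \<bar>u - v\<bar> / c" for u v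
    using expand'[of "k u" "k v"] c(1) by (simp add: hk field_simps abs_minus_commute)
  have "isCont k u" for u
  proof -
    have "(1 / c)-lipschitz_on UNIV k"
      using klip c(1) by (intro lipschitz_onI) (auto simp: dist_real_def)
    then show ?thesis
      using lipschitz_on_continuous_on continuous_on_eq_continuous_at[OF open_UNIV] by blast
  qed
  then have dk: "(k has_real_derivative inverse (g (k u) \<bullet> w)) (at u)" for u
    using dh c(1) c(2)[of "k u"] hk
    by (intro DERIV_inverse_function[where f = h and a = "u - 1" and b = "u + 1"]) auto
  \<comment> \<open>The velocity rescaled to have \<open>w\<close>-component one, that is, the
    derivative with respect to height.\<close>
  define m where "m t = inverse (g t \<bullet> w) *\<^sub>R g t" for t
  have d\<gamma>k: "((\<lambda>u. \<gamma> (k u)) has_vector_derivative m (k u)) (at u)" for u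
    using vector_diff_chain_at[OF dk[unfolded has_real_derivative_iff_has_vector_derivative] d\<gamma>, of u]
    by (simp add: o_def m_def)
  define W where "W = span {w}"
  define \<phi> where "\<phi> z = \<gamma> (k (z \<bullet> w)) - (z \<bullet> w) *\<^sub>R w" for z
  define \<phi>' where "\<phi>' z v = (v \<bullet> w) *\<^sub>R (m (k (z \<bullet> w)) - w)" for z v
  have der: "(\<phi> has_derivative \<phi>' z) (at z within W)" for z
  proof -
    have "((\<lambda>u. \<gamma> (k u) - u *\<^sub>R w) has_derivative (\<lambda>x. x *\<^sub>R (m (k (z \<bullet> w)) - w))) (at (z \<bullet> w))"
      using has_vector_derivative_diff[OF d\<gamma>k[of "z \<bullet> w"]
          has_vector_derivative_scaleR[OF DERIV_ident has_vector_derivative_const[of w]]]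
      by (simp add: has_vector_derivative_def)
    moreover have "((\<lambda>z. z \<bullet> w) has_derivative (\<lambda>v. v \<bullet> w)) (at z)"
      by (intro derivative_eq_intros) auto
    ultimately have "(\<phi> has_derivative \<phi>' z) (at z)"
      using has_derivative_compose[of "\<lambda>z. z \<bullet> w" "\<lambda>v. v \<bullet> w" z UNIV "\<lambda>u. \<gamma> (k u) - u *\<^sub>R w"]
      by (simp add: \<phi>_def[abs_def] \<phi>'_def[abs_def])
    then show ?thesis by (rule has_derivative_at_withinI)
  qed
  \<comment> \<open>The two terms come from varying the numerator and the denominator of
    \<open>m\<close>.\<close>
  define K where "K = 2 * L / c + M * (2 * L) / (c * c)"
  have M0: "0 \<le> M" using order_trans[OF norm_ge_zero M] .
  have K0: "0 \<le> K" using L M0 c(1) by (simp add: K_def)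
  have mlip: "norm (m t - m s) \<le> K * \<bar>t - s\<bar>" for s t
  proof -
    let ?a = "g t \<bullet> w" and ?b = "g s \<bullet> w"
    have ab: "c \<le> ?a" "c \<le> ?b" "0 < ?a" "0 < ?b" using c(2)[of t] c(2)[of s] c(1) by auto
    have "m t - m s = inverse ?a *\<^sub>R (g t - g s) + (inverse ?a - inverse ?b) *\<^sub>R g s"
      by (simp add: m_def algebra_simps)
    then have "norm (m t - m s) \<le> norm (g t - g s) / ?a + \<bar>inverse ?a - inverse ?b\<bar> * norm (g s)"
      using norm_triangle_ineq[of "inverse ?a *\<^sub>R (g t - g s)" "(inverse ?a - inverse ?b) *\<^sub>R g s"] ab
      by (simp add: divide_inverse mult.commute)
    also have "norm (g t - g s) / ?a \<le> (2 * L * \<bar>t - s\<bar>) / c"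
      using lip ab c(1) L by (intro frac_le) auto
    also have "\<bar>inverse ?a - inverse ?b\<bar> * norm (g s) \<le> ((2 * L * \<bar>t - s\<bar>) / (c * c)) * M"
    proof (intro mult_mono M)
      have "inverse ?a - inverse ?b = (?b - ?a) / (?a * ?b)"
        using ab by (simp add: field_simps)
      then have "\<bar>inverse ?a - inverse ?b\<bar> = \<bar>(g t - g s) \<bullet> w\<bar> / (?a * ?b)"
        using ab by (simp add: inner_diff_left abs_mult abs_minus_commute)
      also have "\<dots> \<le> (2 * L * \<bar>t - s\<bar>) / (c * c)"
        using order_trans[OF inner_w lip] ab c(1) L by (intro frac_le mult_mono) auto
      finally show "\<bar>inverse ?a - inverse ?b\<bar> \<le> (2 * L * \<bar>t - s\<bar>) / (c * c)" .
    qed (use L c in auto)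
    finally show ?thesis by (simp add: K_def algebra_simps)
  qed
  have lip': "norm (\<phi>' z v - \<phi>' z' v) \<le> (K / c) * dist z z' * norm v" for z z' v
  proof -
    have "\<phi>' z v - \<phi>' z' v = (v \<bullet> w) *\<^sub>R (m (k (z \<bullet> w)) - m (k (z' \<bullet> w)))"
      by (simp add: \<phi>'_def algebra_simps)
    then have "norm (\<phi>' z v - \<phi>' z' v) = \<bar>v \<bullet> w\<bar> * norm (m (k (z \<bullet> w)) - m (k (z' \<bullet> w)))" by simp
    also have "\<dots> \<le> norm v * ((K / c) * dist z z')"
    proof (intro mult_mono inner_w)
      have "norm (m (k (z \<bullet> w)) - m (k (z' \<bullet> w))) \<le> K * \<bar>k (z \<bullet> w) - k (z' \<bullet> w)\<bar>" by (rule mlip)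
      also have "\<dots> \<le> K * (\<bar>z \<bullet> w - z' \<bullet> w\<bar> / c)" using klip K0 by (intro mult_left_mono) auto
      also have "\<dots> \<le> K * (dist z z' / c)"
        using inner_w[of "z - z'"] K0 c(1)
        by (intro mult_left_mono divide_right_mono) (auto simp: inner_diff_left dist_norm)
      finally show "norm (m (k (z \<bullet> w)) - m (k (z' \<bullet> w))) \<le> (K / c) * dist z z'" by simp
    qed auto
    finally show ?thesis by (simp add: mult_ac)
  qed
  have orth: "\<phi> z \<bullet> v = 0" if "v \<in> W" for z v
    using that hk[of "z \<bullet> w"] ww by (auto simp: W_def span_singleton \<phi>_def h_def inner_diff_left)
  have graph: "range \<gamma> = (\<lambda>z. z + \<phi> z) ` W"
  proof (intro set_eqI iffI)
    fix y assume "y \<in> range \<gamma>"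
    then obtain t where t: "y = \<gamma> t" by blast
    have "h t *\<^sub>R w \<in> W" by (simp add: W_def span_base span_mul)
    moreover have "h t *\<^sub>R w + \<phi> (h t *\<^sub>R w) = y" using ww by (simp add: \<phi>_def kh t)
    ultimately show "y \<in> (\<lambda>z. z + \<phi> z) ` W" by force
  next
    fix y assume "y \<in> (\<lambda>z. z + \<phi> z) ` W"
    then obtain s where "y = s *\<^sub>R w + \<phi> (s *\<^sub>R w)" by (auto simp: W_def span_singleton)
    then have "y = \<gamma> (k s)" using ww by (simp add: \<phi>_def)
    then show "y \<in> range \<gamma>" by blast
  qed
  have "subspace W" "dim W = 1" using w by (auto simp: W_def)
  then show ?thesis
    unfolding C11_surface_1_def using orth der lip' graph by blast
qed

text \<open>The positive factors in \<open>Tan\<close> do not affect angles, so chords converging to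
  \<open>w\<close> after rescaling are eventually almost parallel to \<open>w\<close>.\<close>

lemma Tan_unit_direction:
  fixes A :: "'a::real_inner set"
  assumes "w \<in> Tan A a" "norm w = 1" "0 < \<rho>"
  obtains q where "q \<in> A" "q \<noteq> a" "dist q a < \<rho>" "9/10 * dist q a \<le> (q - a) \<bullet> w"
proof -
  have "w \<noteq> 0" using assms by auto
  then obtain xs k where xs: "\<And>i. xs i \<in> A \<and> xs i \<noteq> a \<and> k i > (0::real)" "xs \<longlonglongrightarrow> a"
    and lim: "(\<lambda>i. k i *\<^sub>R (xs i - a)) \<longlonglongrightarrow> w"
    using assms(1) unfolding Tan_def by auto
  have "(\<lambda>i. norm (k i *\<^sub>R (xs i - a))) \<longlonglongrightarrow> 1" using tendsto_norm[OF lim] assms(2) by simp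
  \<comment> \<open>The bounds 105/100 and 95/100 fit together because 9/10 of the former is below
    the latter.\<close>
  then have "\<forall>\<^sub>F i in sequentially. norm (k i *\<^sub>R (xs i - a)) < 105/100" by (rule order_tendstoD) simp
  moreover have "(\<lambda>i. (k i *\<^sub>R (xs i - a)) \<bullet> w) \<longlonglongrightarrow> w \<bullet> w" by (intro tendsto_intros lim)
  then have "\<forall>\<^sub>F i in sequentially. (k i *\<^sub>R (xs i - a)) \<bullet> w > 95/100"
    by (rule order_tendstoD) (use assms(2) in \<open>simp add: dot_square_norm\<close>)
  moreover have "\<forall>\<^sub>F i in sequentially. dist (xs i) a < \<rho>" using xs(2) assms(3) by (rule tendstoD)
  ultimately have "\<forall>\<^sub>F i in sequentially. norm (k i *\<^sub>R (xs i - a)) < 105/100 \<and>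
      (k i *\<^sub>R (xs i - a)) \<bullet> w > 95/100 \<and> dist (xs i) a < \<rho>" by eventually_elim simp
  then obtain i where i: "norm (k i *\<^sub>R (xs i - a)) < 105/100" "(k i *\<^sub>R (xs i - a)) \<bullet> w > 95/100"
    "dist (xs i) a < \<rho>" using eventually_happens'[OF sequentially_bot] by blast
  have "9/10 * norm (k i *\<^sub>R (xs i - a)) \<le> (k i *\<^sub>R (xs i - a)) \<bullet> w" using i by linarith
  then have "k i * (9/10 * dist (xs i) a) \<le> k i * ((xs i - a) \<bullet> w)"
    using xs(1)[of i] by (simp add: dist_norm)
  then have "9/10 * dist (xs i) a \<le> (xs i - a) \<bullet> w" using xs(1)[of i] mult_le_cancel_left_pos by blast
  then show thesis using that[of "xs i"] xs(1)[of i] i(3) by blast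
qed

theorem theorem4p4:
  fixes A :: "'a::euclidean_space set" and a :: 'a
  assumes "DIM('a) \<ge> 2"
    and "positive_reach A"
    and "a \<in> T1_plus A"
  shows "\<exists>\<Gamma> \<delta>. C11_surface_1 \<Gamma> \<and> \<delta> > 0 \<and>
           T1 A \<inter> ball a \<delta> \<subseteq> \<Gamma> \<inter> ball a \<delta> \<and> \<Gamma> \<inter> ball a \<delta> \<subseteq> A"
proof -
  obtain r where A: "reach_at_least r A"
    using positive_reach_imp_reach_at_least[OF assms(2)] by blast
  then have r: "r > 0" by (simp add: reach_at_least_def)
  have aA: "a \<in> A" and dim1: "dim (span (Tan A a)) = 1" and tan: "Tan A a = span (Tan A a)"
    using assms(3) by (auto simp: T1_plus_def T1_def)
  obtain u where u: "u \<in> span (Tan A a)" "u \<noteq> 0"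
    using dim1 dim_eq_0[of "span (Tan A a)"] by auto
  define w where "w = u /\<^sub>R norm u"
  have w: "norm w = 1" using u by (simp add: w_def)
  have "w \<in> span (Tan A a)" using u by (simp add: w_def span_mul)
  then have "span {w} = span (Tan A a)"
    using dim1 w by (intro subspace_dim_equal) (auto simp: span_minimal)
  then have Ta: "Tan A a = span {w}" using tan by simp
  then have wT: "w \<in> Tan A a" "- w \<in> Tan A a" by (auto simp: span_base span_neg)
  have inner_w: "\<bar>z \<bullet> w\<bar> \<le> norm z" for z using Cauchy_Schwarz_ineq2[of z w] w by simp

  \<comment> \<open>Chosen so that \<open>8 * \<rho> = r / 64\<close>, the radius in
    \<open>T1_fibre_unique\<close>.\<close>
  define \<rho> where "\<rho> = r / 512"
  have \<rho>: "\<rho> > 0" using r by (simp add: \<rho>_def)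
  obtain q where q: "q \<in> A" "q \<noteq> a" "dist q a < \<rho>" "9/10 * dist q a \<le> (q - a) \<bullet> w"
    using Tan_unit_direction[OF wT(1) w \<rho>] by blast
  obtain p where p: "p \<in> A" "p \<noteq> a" "dist p a < \<rho>" "9/10 * dist p a \<le> (p - a) \<bullet> (- w)"
    using Tan_unit_direction[OF wT(2) _ \<rho>] w by auto
  define D where "D = dist p q"
  have "D \<le> dist p a + dist q a" unfolding D_def by (metis dist_triangle2)
  then have D: "D < 2 * \<rho>" "9/10 * D \<le> (q - p) \<bullet> w"
    using p q by (auto simp: inner_diff_left)
  have "0 < dist q a" "0 < dist p a" using p q by auto
  then have "0 < (q - a) \<bullet> w" "0 < (p - a) \<bullet> (- w)" using p(4) q(4) by linarith+
  then have side: "0 < (q - a) \<bullet> w" "0 < (a - p) \<bullet> w" by (auto simp: inner_diff_left)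
  then have D0: "D > 0" by (auto simp: D_def inner_diff_left)
  define L where "L = 8 * D\<^sup>2 / r"
  \<comment> \<open>Velocities thus differ from \<open>q - p\<close> by at most
    \<open>D / 16\<close>, while the \<open>w\<close>-component of \<open>q - p\<close> is at least
    \<open>9/10 * D\<close>; this leaves \<open>D / 2\<close> for \<open>gw\<close>.\<close>
  have LD: "L \<le> D / 16"
    using mult_left_mono[of "128 * D" r D] D D0 r by (simp add: L_def \<rho>_def power2_eq_square field_simps)
  have small: "dist p q \<le> r / 8" using D r by (simp add: D_def \<rho>_def)
  obtain \<gamma> g :: "real \<Rightarrow> 'a" where \<gamma>: "\<gamma> 0 = p" "\<gamma> 1 = q" "\<And>t. 0 \<le> t \<Longrightarrow> t \<le> 1 \<Longrightarrow> \<gamma> t \<in> A"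
    and taylor: "\<And>s t. norm (\<gamma> t - \<gamma> s - (t - s) *\<^sub>R g s) \<le> L * (t - s)\<^sup>2"
    and g: "\<And>t. norm (g t - (q - p)) \<le> L"
    using C11_curve_in_reach[OF A p(1) q(1) small] unfolding L_def D_def by metis
  have gw: "D / 2 \<le> g t \<bullet> w" for t
    using inner_w[of "g t - (q - p)"] g[of t] LD D D0 by (simp add: inner_diff_left)
  have gn: "norm (g t) \<le> 2 * D" for t
  proof -
    have "norm (q - p) = D" by (simp add: D_def dist_norm norm_minus_commute)
    then show ?thesis using norm_triangle_sub[of "g t" "q - p"] g[of t] LD D0 by linarith
  qed
  have surf: "C11_surface_1 (range \<gamma>)"
    using C11_surface_1_range[OF taylor w _ gw gn] D0 by simp
  define h where "h t = \<gamma> t \<bullet> w" for t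
  have dh: "(h has_real_derivative (g s \<bullet> w)) (at s)" for s
    using bounded_linear.has_vector_derivative[OF bounded_linear_inner_left taylor_imp_has_vector_derivative[OF taylor], of w s]
    unfolding h_def has_real_derivative_iff_has_vector_derivative .
  have mono: "h s \<le> h t" if "s \<le> t" for s t
    using that
  proof (rule DERIV_nonneg_imp_nondecreasing)
    show "\<exists>y. (h has_real_derivative y) (at x) \<and> 0 \<le> y" for x
      using dh[of x] gw[of x] D0 by (intro exI[of _ "g x \<bullet> w"]) simp
  qed

  \<comment> \<open>Makes all heights in the ball lie strictly between those of \<open>p\<close> and
    \<open>q\<close>. By monotonicity, the parts of the extended curve outside
    \<open>[0, 1]\<close>, which may leave \<open>A\<close>, do not meet the ball.\<close>
  define \<delta> where "\<delta> = min \<rho> (min ((q - a) \<bullet> w) ((a - p) \<bullet> w))"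
  have \<delta>: "0 < \<delta>" "\<delta> \<le> \<rho>" "h 0 \<le> a \<bullet> w - \<delta>" "a \<bullet> w + \<delta> \<le> h 1"
    using side \<rho> by (auto simp: \<delta>_def h_def \<gamma> inner_diff_left)
  have hb: "a \<bullet> w - \<delta> < y \<bullet> w \<and> y \<bullet> w < a \<bullet> w + \<delta>" if "y \<in> ball a \<delta>" for y
    using that inner_w[of "y - a"] by (auto simp: dist_norm norm_minus_commute inner_diff_left)
  have "range \<gamma> \<inter> ball a \<delta> \<subseteq> A"
  proof clarify
    fix t assume t: "\<gamma> t \<in> ball a \<delta>"
    have "h 0 < h t" "h t < h 1" using hb[OF t] \<delta> by (auto simp: h_def)
    then have "0 \<le> t" "t \<le> 1" using mono[of t 0] mono[of 1 t] by linarith+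
    then show "\<gamma> t \<in> A" by (rule \<gamma>(3))
  qed
  moreover have "x \<in> range \<gamma>" if x: "x \<in> T1 A" "x \<in> ball a \<delta>" for x
  proof -
    \<comment> \<open>The intermediate value theorem finds a curve point in the fibre of
      \<open>x\<close>.\<close>
    have "continuous_on {0..1} h"
      using dh by (intro continuous_at_imp_continuous_on) (auto intro: DERIV_isCont)
    moreover have "h 0 \<le> x \<bullet> w" "x \<bullet> w \<le> h 1" using hb[OF x(2)] \<delta> by auto
    ultimately obtain t where t: "0 \<le> t" "t \<le> 1" "h t = x \<bullet> w"
      using IVT'[of h 0 "x \<bullet> w" 1] by auto
    have L0: "0 \<le> L" using r by (simp add: L_def)
    have "norm (\<gamma> t - p - t *\<^sub>R g 0) \<le> L * t\<^sup>2" using taylor[of t 0] by (simp add: \<gamma>)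
    also have "\<dots> \<le> L * 1" using t L0 by (intro mult_left_mono power_le_one) auto
    finally have 1: "norm (\<gamma> t - p - t *\<^sub>R g 0) \<le> L" by simp
    have 2: "norm (t *\<^sub>R g 0) \<le> 2 * D"
      using mult_mono[of t 1 "norm (g 0)" "2 * D"] t gn[of 0] by simp
    have "norm (\<gamma> t - p) \<le> L + 2 * D"
      using norm_triangle_mono[OF 1 2] by simp
    then have "dist (\<gamma> t) p \<le> 3 * D" using LD D0 by (simp add: dist_norm)
    moreover have "dist x (\<gamma> t) \<le> dist x a + dist a p + dist p (\<gamma> t)"
      using dist_triangle[of x "\<gamma> t" a] dist_triangle[of a "\<gamma> t" p] by linarith
    \<comment> \<open>One \<rho> each from \<open>x\<close> to \<open>a\<close> and from
      \<open>a\<close> to \<open>p\<close>, and \<open>3 * D < 6 * \<rho>\<close> along the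
      curve.\<close>
    ultimately have "dist x (\<gamma> t) \<le> 8 * \<rho>"
      using x(2) D p(3) \<delta> by (simp add: dist_commute)
    then have "\<gamma> t = x"
      using x(2) \<delta> r t \<gamma>(3)[of t]
      by (intro T1_fibre_unique[OF A aA Ta w x(1)]) (auto simp: \<rho>_def h_def inner_diff_left dist_commute)
    then show ?thesis by auto
  qed
  ultimately show ?thesis
    using surf \<delta>(1) by (intro exI[of _ "range \<gamma>"] exI[of _ \<delta>]) auto
qed

end
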